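(* For every fixed integer $n\ge 3$ there exist constants $c_n,C_n>0$ (depending only on $n$) such that the following holds for every integer $N\ge 1$ and every $a=(a_1,\dots,a_n)\in\Delta_N^{(n)}$ with $a_1\ge a_2\ge\cdots\ge a_n$. Let $g:\Delta_N^{(n)}\to\mathbb R$ satisfy $g(a)\ne 0$ and $$\left|\sum_{i=1}^n g(\beta+e_i)\right|\le \mathrm e^{-C_nN}\,|g(a)|\qquad\text{for all }\beta\in\Delta_{N-1}^{(n)}.$$ Then $$\#\left\{\alpha\in\Delta_N^{(n)}:\ |g(\alpha)|\ge \mathrm e^{-C_nN}\,|g(a)|\right\}\ \ge\ c_n\,\Phi_n(a),$$ where $$\Phi_n(a):=\frac{(a_n+1)\prod_{i=1}^{n-2}(a_i+1)}{(N+1)^{h_0}},\qquad h_0=\left\lfloor\frac{n-2}{2}\right\rfloor.$$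
   Context: For integers $N\ge 0$ and $n\ge 1$, $\Delta_N^{(n)}:=\{\alpha=(\alpha_1,\dots,\alpha_n)\in\mathbb Z_{\ge 0}^n:\ \sum_{i=1}^n\alpha_i=N\}$ is the simplex lattice. $e_i$ denotes the $i$th coordinate vector in $\mathbb Z^n$, $\mathrm e$ is Euler's number, and $\#$ denotes cardinality. (The ordering assumption on $a$ can always be achieved by a permutation of the coordinates.) *)

theory Defs
  imports Complex_Main
begin

text \<open>
  A vector \<open>(\<alpha>\<^sub>1, \<dots>, \<alpha>\<^sub>n)\<close> of nonnegative integers is a function \<open>nat \<Rightarrow> nat\<close> vanishing
  outside \<open>{1..n}\<close>. The support condition makes the representation unique, so that cardinalities
  of sets of such functions are the intended ones.
\<close>

definition simplex_lattice :: "nat \<Rightarrow> nat \<Rightarrow> (nat \<Rightarrow> nat) set" where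
  "simplex_lattice n N = {\<alpha>. (\<forall>i. i \<notin> {1..n} \<longrightarrow> \<alpha> i = 0) \<and> (\<Sum>i = 1..n. \<alpha> i) = N}"

definition coord_vec :: "nat \<Rightarrow> nat \<Rightarrow> nat" where
  "coord_vec i = (\<lambda>j. if j = i then 1 else 0)"

definition vec_add :: "(nat \<Rightarrow> nat) \<Rightarrow> (nat \<Rightarrow> nat) \<Rightarrow> nat \<Rightarrow> nat" where
  "vec_add \<alpha> \<beta> = (\<lambda>j. \<alpha> j + \<beta> j)"

text \<open>For \<open>n \<ge> 2\<close> the natural number \<open>(n - 2) div 2\<close> is the floor of \<open>(n - 2) / 2\<close>.\<close>

definition Phi :: "nat \<Rightarrow> nat \<Rightarrow> (nat \<Rightarrow> nat) \<Rightarrow> real" where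
  "Phi n N a = (real (a n) + 1) * (\<Prod>i = 1..n - 2. (real (a i) + 1))
                 / (real N + 1) ^ ((n - 2) div 2)"

lemma finite_simplex_lattice: "finite (simplex_lattice n N)"
proof (rule finite_subset)
  show "simplex_lattice n N \<subseteq> {\<alpha>. \<forall>i. (i \<in> {1..n} \<longrightarrow> \<alpha> i \<in> {..N}) \<and> (i \<notin> {1..n} \<longrightarrow> \<alpha> i = 0)}"
  proof
    fix \<alpha> assume "\<alpha> \<in> simplex_lattice n N"
    then have supp: "\<And>i. i \<notin> {1..n} \<Longrightarrow> \<alpha> i = 0" and sum: "(\<Sum>i = 1..n. \<alpha> i) = N"
      by (simp_all add: simplex_lattice_def)
    have "\<alpha> i \<le> N" if "i \<in> {1..n}" for i
      using member_le_sum[of i "{1..n}" \<alpha>] that sum by simp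
    with supp show "\<alpha> \<in> {\<alpha>. \<forall>i. (i \<in> {1..n} \<longrightarrow> \<alpha> i \<in> {..N}) \<and> (i \<notin> {1..n} \<longrightarrow> \<alpha> i = 0)}"
      by blast
  qed
  show "finite {\<alpha> :: nat \<Rightarrow> nat. \<forall>i. (i \<in> {1..n} \<longrightarrow> \<alpha> i \<in> {..N}) \<and> (i \<notin> {1..n} \<longrightarrow> \<alpha> i = 0)}"
    by (rule finite_set_of_finite_funs) simp_all
qed

lemma vec_add_coord_vec_mem:
  assumes "\<beta> \<in> simplex_lattice n N" "i \<in> {1..n}"
  shows "vec_add \<beta> (coord_vec i) \<in> simplex_lattice n (Suc N)"
  using assms by (auto simp: simplex_lattice_def vec_add_def coord_vec_def sum.distrib)

end

theory Submission
  imports Defs "HOL-Library.FuncSet"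
begin

text \<open>
  Up to an exponentially small error, the recurrence says that \<open>g\<close> is a functional on polynomials
  vanishing on the multiples of \<open>x\<^sub>1 + \<dots> + x\<^sub>n\<close>. Restricting it to multiples of a power of one
  variable, or identifying two variables, produces functions of fewer variables with the same
  property, and large values lift back at an exponential loss.

  The core is the case of three variables \<open>z, y, r\<close>. There \<open>g\<close> is determined by its values
  \<open>f j\<close> on the facet \<open>z = 0\<close>: the slice \<open>r = j\<close> is, up to signs, the \<open>j\<close>-th difference of the
  binomial transform of \<open>f\<close>. If for all but few \<open>j\<close> both ends of the slice are small, then
  differencing (with a discrete Rolle argument that tracks the geometric mean of the values) turns a
  single large value into a long alternating chain of large values, while Descartes' rule of signs
  bounds its length by the number of exceptional \<open>j\<close>. Hence \<open>g a \<noteq> 0\<close> forces at least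
  \<open>(a r + 1) / 64\<close> values \<open>j\<close> for which a large point with \<open>r = j\<close> lies on the facet \<open>z = 0\<close> or on
  the facet \<open>y = 0\<close>.

  Iterating over the variables \<open>1, \<dots>, n - 2\<close>, each step fixes a coordinate at such a \<open>j\<close> and merges the
  variable into the one that vanishes. This yields \<open>\<Prod> (a\<^sub>i + 1) / 64\<close> exponent patterns, each
  shared between a large point with \<open>z = 0\<close> and one with \<open>y = 0\<close>; at most \<open>h\<^sub>0\<close>
  coordinates of a pattern are lost by keeping the better one of the two. Dividing first by \<open>(x\<^sub>z x\<^sub>y)\<^sup>t\<close> for
  \<open>t \<le> a\<^sub>n\<close> makes the resulting points disjoint for different \<open>t\<close> and gives the factor \<open>a\<^sub>n + 1\<close>.
\<close>

section \<open>Binomial sums and finite differences\<close>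

text \<open>The binomial transform: the sequence whose Newton coefficients are \<open>c\<close>, so
  that differencing only shifts \<open>c\<close>.\<close>

definition bsum :: "(nat \<Rightarrow> real) \<Rightarrow> nat \<Rightarrow> real" where
  "bsum c k = (\<Sum>i\<le>k. real (k choose i) * c i)"

definition dif :: "(nat \<Rightarrow> real) \<Rightarrow> nat \<Rightarrow> real" where
  "dif u k = u (Suc k) - u k"

text \<open>Pascal's rule under the sum. It drives both the recursion for \<open>bsum\<close> and
  the inheritance of the recurrence under \<open>merge\<close>.\<close>

lemma binomial_sum_Suc:
  fixes F :: "nat \<Rightarrow> real"
  shows "(\<Sum>i\<le>Suc k. real (Suc k choose i) * F i)
    = (\<Sum>i\<le>k. real (k choose i) * (F i + F (Suc i)))"
proof -
  have "(\<Sum>i\<le>Suc k. real (Suc k choose i) * F i)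
      = F 0 + (\<Sum>i\<le>k. real (k choose i) * F (Suc i) + real (k choose Suc i) * F (Suc i))"
    by (subst sum.atMost_Suc_shift) (simp add: algebra_simps)
  also have "\<dots> = (F 0 + (\<Sum>i\<le>k. real (k choose Suc i) * F (Suc i)))
      + (\<Sum>i\<le>k. real (k choose i) * F (Suc i))"
    by (simp add: sum.distrib)
  also have "F 0 + (\<Sum>i\<le>k. real (k choose Suc i) * F (Suc i))
      = (\<Sum>i\<le>Suc k. real (k choose i) * F i)"
    by (subst sum.atMost_Suc_shift) simp
  also have "\<dots> = (\<Sum>i\<le>k. real (k choose i) * F i)"
    by simp
  finally show ?thesis
    by (simp add: sum.distrib algebra_simps)
qed

lemma bsum_0 [simp]: "bsum c 0 = c 0"
  by (simp add: bsum_def)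

lemma bsum_zero [simp]: "bsum (\<lambda>i. 0) = (\<lambda>k. 0)"
  by (simp add: bsum_def fun_eq_iff)

lemma bsum_Suc: "bsum c (Suc k) = bsum c k + bsum (\<lambda>i. c (Suc i)) k"
  unfolding bsum_def binomial_sum_Suc by (simp add: sum.distrib algebra_simps)

lemma dif_bsum: "dif (bsum c) = bsum (\<lambda>i. c (Suc i))"
  by (simp add: fun_eq_iff dif_def bsum_Suc)

lemma dif_pow_bsum: "(dif ^^ j) (bsum c) = bsum (\<lambda>i. c (i + j))"
  by (induction j) (simp_all add: dif_bsum)

text \<open>Newton's forward difference formula.\<close>

lemma bsum_newton: "w k = bsum (\<lambda>j. (dif ^^ j) w 0) k"
proof (induction k arbitrary: w)
  case (Suc k)
  have "w (Suc k) = w k + dif w k" by (simp add: dif_def)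
  also have "\<dots> = bsum (\<lambda>j. (dif ^^ j) w 0) k + bsum (\<lambda>j. (dif ^^ j) (dif w) 0) k"
    using Suc.IH by metis
  also have "\<dots> = bsum (\<lambda>j. (dif ^^ j) w 0) (Suc k)"
    by (simp add: bsum_Suc funpow_swap1)
  finally show ?case .
qed simp

lemma dif_pow_Suc: "(dif ^^ Suc j) u k = (dif ^^ j) u (Suc k) - (dif ^^ j) u k"
  by (simp only: funpow.simps o_apply dif_def)

text \<open>The \<open>j\<close>-th difference at \<open>k\<close> sees only the values on
  \<open>{k..k + j}\<close>, with weights of total size \<open>2 ^ j\<close>. The window matters
  because sequences are later modified near their ends only.\<close>

lemma dif_pow_diff_le:
  assumes "\<And>i. k \<le> i \<Longrightarrow> i \<le> k + j \<Longrightarrow> \<bar>u i - v i\<bar> \<le> \<eta>"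
  shows "\<bar>(dif ^^ j) u k - (dif ^^ j) v k\<bar> \<le> 2 ^ j * \<eta>"
  using assms
proof (induction j arbitrary: k)
  case (Suc j)
  have "\<bar>(dif ^^ j) u k - (dif ^^ j) v k\<bar> \<le> 2 ^ j * \<eta>"
    and "\<bar>(dif ^^ j) u (Suc k) - (dif ^^ j) v (Suc k)\<bar> \<le> 2 ^ j * \<eta>"
    using Suc.prems by (auto intro!: Suc.IH)
  then show ?case by (simp add: dif_pow_Suc del: funpow.simps)
qed simp

lemma dif_pow_cong:
  assumes "\<And>i. k \<le> i \<Longrightarrow> i \<le> k + j \<Longrightarrow> u i = v i"
  shows "(dif ^^ j) u k = (dif ^^ j) v k"
  using dif_pow_diff_le[of k j u v 0] assms by simp

lemma dif_pow_zero [simp]: "(dif ^^ j) (\<lambda>k. 0) = (\<lambda>k. 0)"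
  by (induction j) (simp_all add: fun_eq_iff dif_def)

lemma dif_pow_le:
  assumes "\<And>i. k \<le> i \<Longrightarrow> i \<le> k + j \<Longrightarrow> \<bar>u i\<bar> \<le> \<eta>"
  shows "\<bar>(dif ^^ j) u k\<bar> \<le> 2 ^ j * \<eta>"
  using dif_pow_diff_le[of k j u "\<lambda>k. 0" \<eta>] assms by simp

text \<open>Reversal exchanges the two ends, so that data at the right ends of rows can be read as
  Newton coefficients.\<close>

lemma dif_pow_reflect:
  assumes "k + j \<le> L"
  shows "(dif ^^ j) (\<lambda>k. u (L - k)) k = (-1) ^ j * (dif ^^ j) u (L - k - j)"
  using assms
proof (induction j arbitrary: k)
  case (Suc j)
  have "Suc (L - k - Suc j) = L - k - j" and "L - Suc k - j = L - k - Suc j"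
    using Suc.prems by simp_all
  then show ?case
    using Suc.IH[of k] Suc.IH[of "Suc k"] Suc.prems
    by (simp add: dif_pow_Suc algebra_simps del: funpow.simps)
qed simp

lemma bsum_diff: "bsum c k - bsum d k = bsum (\<lambda>i. c i - d i) k"
  by (simp add: bsum_def sum_subtractf algebra_simps)

lemma bsum_le:
  assumes "\<And>i. i \<le> k \<Longrightarrow> \<bar>c i\<bar> \<le> \<theta>"
  shows "\<bar>bsum c k\<bar> \<le> 2 ^ k * \<theta>"
proof -
  have "\<bar>bsum c k\<bar> \<le> (\<Sum>i\<le>k. real (k choose i) * \<theta>)"
    unfolding bsum_def
    by (rule order.trans[OF sum_abs sum_mono]) (use assms in \<open>auto simp: abs_mult intro!: mult_left_mono\<close>)
  also have "\<dots> = real (\<Sum>i\<le>k. k choose i) * \<theta>"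
    by (simp add: sum_distrib_right)
  finally show ?thesis by (simp add: choose_row_sum)
qed

text \<open>Binomial inversion: \<open>c n\<close> is the \<open>n\<close>-th difference of
  \<open>bsum c\<close> at \<open>0\<close>.\<close>

lemma bsum_inverse_le:
  assumes "\<And>m. m \<le> n \<Longrightarrow> \<bar>bsum c m\<bar> \<le> \<eta>"
  shows "\<bar>c n\<bar> \<le> 2 ^ n * \<eta>"
  using dif_pow_le[of 0 n "bsum c" \<eta>] assms by (simp add: dif_pow_bsum)

section \<open>Alternating chains\<close>

text \<open>
  A chain is a sequence of \<open>n\<close> increasing points at which \<open>u\<close> alternates in sign, starting with the
  sign \<open>s\<close>. Between two consecutive points \<open>u\<close> jumps, so its difference sequence has an alternating
  chain again; the logarithms of the values lose only the logarithm of the gap.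
\<close>

definition chain :: "(nat \<Rightarrow> real) \<Rightarrow> nat \<Rightarrow> nat \<Rightarrow> real \<Rightarrow> (nat \<Rightarrow> nat) \<Rightarrow> bool" where
  "chain u L n s x \<longleftrightarrow> \<bar>s\<bar> = 1 \<and> (\<forall>l. Suc l < n \<longrightarrow> x l < x (Suc l)) \<and>
     (\<forall>l<n. x l \<le> L \<and> 0 < s * (-1) ^ l * u (x l))"

lemma steps_less_mono:
  fixes p :: "nat \<Rightarrow> nat"
  assumes "\<And>l. l < m \<Longrightarrow> p l < p (Suc l)" "i \<le> j" "j \<le> m"
  shows "p i + (j - i) \<le> p j"
  using assms(2,3)
proof (induction j rule: dec_induct)
  case (step j)
  then show ?case using assms(1)[of j] by simp
qed simp

text \<open>Nodes \<open>p\<close> and lower bounds \<open>d\<close> for the jumps are left free, so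
  that a zero endpoint can be adjoined at both ends, at one end or at neither. The total loss is
  worst for equal gaps \<open>L / m\<close>.\<close>

lemma chain_lift:
  assumes s: "\<bar>s\<bar> = 1"
    and "\<forall>l<m. p l < p (Suc l)" "p m \<le> L" "\<forall>l<m. 0 < d l"
    and "\<forall>l<m. d l \<le> s * (-1) ^ l * (u (p (Suc l)) - u (p l))"
  shows "\<exists>y. chain (dif u) (L - 1) m s y \<and>
    (\<Sum>l<m. ln (d l)) + real m * ln (real m / real L) \<le> (\<Sum>l<m. ln (s * (-1) ^ l * dif u (y l)))"
proof -
  have p: "\<And>l. l < m \<Longrightarrow> p l < p (Suc l)" "p m \<le> L"
    and d: "\<And>l. l < m \<Longrightarrow> 0 < d l"
    and step: "\<And>l. l < m \<Longrightarrow> d l \<le> s * (-1) ^ l * (u (p (Suc l)) - u (p l))"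
    using assms by blast+
  \<comment> \<open>The increments of \<open>u\<close> over a gap add up to the jump, so one of them
    reaches the average.\<close>
  have "\<exists>y. p l \<le> y \<and> y < p (Suc l) \<and> d l / real (p (Suc l) - p l) \<le> s * (-1) ^ l * dif u y"
    if l: "l < m" for l
  proof (rule ccontr)
    assume "\<not> ?thesis"
    then have less: "s * (-1) ^ l * dif u y < d l / real (p (Suc l) - p l)"
      if "y \<in> {p l..<p (Suc l)}" for y using that by force
    have "s * (-1) ^ l * (u (p (Suc l)) - u (p l)) = (\<Sum>y = p l..<p (Suc l). s * (-1) ^ l * dif u y)"
      using p(1)[OF l] by (simp add: sum_Suc_diff' dif_def flip: sum_distrib_left)
    also have "\<dots> < (\<Sum>y = p l..<p (Suc l). d l / real (p (Suc l) - p l))"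
      using p(1)[OF l] less by (intro sum_strict_mono) auto
    also have "\<dots> = d l"
      using p(1)[OF l] by simp
    finally show False using step[OF l] by simp
  qed
  then obtain y where y: "\<And>l. l < m \<Longrightarrow> p l \<le> y l" "\<And>l. l < m \<Longrightarrow> y l < p (Suc l)"
      "\<And>l. l < m \<Longrightarrow> d l / real (p (Suc l) - p l) \<le> s * (-1) ^ l * dif u (y l)"
    by metis
  have gap: "0 < real (p (Suc l) - p l)" if "l < m" for l
    using p(1)[OF that] by simp
  have pos: "0 < s * (-1) ^ l * dif u (y l)" if "l < m" for l
    using y(3)[OF that] d[OF that] gap[OF that] by (meson divide_pos_pos less_le_trans)
  have p_le: "y l \<le> L - 1" if "l < m" for l
    using y(2)[OF that] steps_less_mono[of m p "Suc l" m] p that by (simp add: Suc_le_eq)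
  have y_mono: "y l < y (Suc l)" if "Suc l < m" for l
    using y(2)[of l] y(1)[of "Suc l"] that by simp
  \<comment> \<open>This is \<open>ln t \<le> t - 1\<close> with \<open>t\<close> the gap times
    \<open>m / L\<close>. The gaps add up to at most \<open>L\<close>, so the terms
    \<open>t - 1\<close> add up to at most \<open>0\<close>.\<close>
  have ln_gap: "ln (real (p (Suc l) - p l)) \<le> real (p (Suc l) - p l) * (m / L) - 1 + ln (L / m)"
    if "l < m" for l
  proof -
    have mL: "0 < real m" "0 < real L"
      using steps_less_mono[of m p 0 m] p that by auto
    have "ln (real (p (Suc l) - p l)) = ln (real (p (Suc l) - p l) * (m / L)) + ln (L / m)"
      using mL gap[OF that] by (simp add: ln_mult ln_div)
    also have "ln (real (p (Suc l) - p l) * (m / L)) \<le> real (p (Suc l) - p l) * (m / L) - 1"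
      using mL gap[OF that] by (intro ln_le_minus_one) simp
    finally show ?thesis by simp
  qed
  have "(\<Sum>l<m. ln (d l)) + real m * ln (real m / real L) \<le> (\<Sum>l<m. ln (s * (-1) ^ l * dif u (y l)))"
  proof (cases "m = 0")
    case False
    then have mL: "0 < real m" "0 < real L"
      using steps_less_mono[of m p 0 m] p by auto
    have "(\<Sum>l<m. real (p (Suc l) - p l)) = (\<Sum>l<m. real (p (Suc l)) - real (p l))"
      using p(1) by (intro sum.cong) (auto simp: less_imp_le of_nat_diff)
    also have "\<dots> = real (p m) - real (p 0)"
      by (rule sum_lessThan_telescope)
    also have "\<dots> \<le> L" using p(2) by simp
    finally have "(\<Sum>l<m. real (p (Suc l) - p l)) * (m / L) \<le> m"
      using mL by (simp add: field_simps)
    moreover have "(\<Sum>l<m. ln (real (p (Suc l) - p l)))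
        \<le> (\<Sum>l<m. real (p (Suc l) - p l) * (m / L) - 1 + ln (L / m))"
      using ln_gap by (intro sum_mono) simp
    ultimately have gaps: "(\<Sum>l<m. ln (real (p (Suc l) - p l))) \<le> real m * ln (L / m)"
      by (simp add: sum.distrib sum_subtractf sum_distrib_right sum_divide_distrib)
    have "ln (d l) - ln (real (p (Suc l) - p l)) \<le> ln (s * (-1) ^ l * dif u (y l))" if "l < m" for l
    proof -
      have "ln (d l) - ln (real (p (Suc l) - p l)) = ln (d l / real (p (Suc l) - p l))"
        by (subst ln_divide_pos) (use d[OF that] gap[OF that] in simp_all)
      also have "\<dots> \<le> ln (s * (-1) ^ l * dif u (y l))"
        by (rule ln_mono) (use y(3)[OF that] divide_pos_pos[OF d[OF that] gap[OF that]] in simp_all)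
      finally show ?thesis .
    qed
    then have "(\<Sum>l<m. ln (d l) - ln (real (p (Suc l) - p l))) \<le> (\<Sum>l<m. ln (s * (-1) ^ l * dif u (y l)))"
      by (intro sum_mono) simp
    moreover have "ln (real m / real L) = - ln (L / m)"
      using mL by (simp add: ln_div)
    ultimately show ?thesis
      using gaps by (simp add: sum_subtractf)
  qed simp
  moreover have "chain (dif u) (L - 1) m s y"
    unfolding chain_def using s p_le y_mono pos by simp
  ultimately show ?thesis by iprover
qed

lemma ln_add_ge_mean:
  fixes a b w :: real
  assumes "0 < a" "0 < b" "0 \<le> w" "w \<le> 1"
  shows "w * ln a + (1 - w) * ln b \<le> ln (a + b)"
proof -
  have "w * ln a \<le> w * ln (a + b)" "(1 - w) * ln b \<le> (1 - w) * ln (a + b)"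
    using assms by (auto intro!: mult_left_mono)
  then show ?thesis by (simp add: algebra_simps)
qed

text \<open>
  Two zero endpoints lengthen the chain by one. A jump is bounded below by a geometric mean of the
  two adjacent values, with weights chosen so that every old value is counted equally often.
\<close>

lemma chain_grow:
  assumes u: "u 0 = 0" "u L = 0" and n: "0 < n" and c: "chain u L n s x"
    and T: "real n * T \<le> (\<Sum>l<n. ln (s * (-1) ^ l * u (x l)))"
  shows "\<exists>y. chain (dif u) (L - 1) (Suc n) s y \<and>
    real (Suc n) * (T + ln (real (Suc n) / real L)) \<le> (\<Sum>l<Suc n. ln (s * (-1) ^ l * dif u (y l)))"
proof -
  define P where "P l = s * (-1) ^ l * u (x l)" for l
  \<comment> \<open>The nodes are the old points together with the zeros \<open>0\<close> and
    \<open>L\<close> of \<open>u\<close>.\<close>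
  define p where "p l = (if l = 0 then 0 else if l = Suc n then L else x (l - 1))" for l
  define d where "d l = (if l = 0 then 0 else P (l - 1)) + (if l = n then 0 else P l)" for l
  have s: "\<bar>s\<bar> = 1" and incr: "\<And>l. Suc l < n \<Longrightarrow> x l < x (Suc l)"
    and xL: "\<And>l. l < n \<Longrightarrow> x l \<le> L" and P: "\<And>l. l < n \<Longrightarrow> 0 < P l"
    using c unfolding chain_def P_def by auto
  have x0: "x l \<noteq> 0" "x l \<noteq> L" if "l < n" for l
    using P[OF that] u by (metis P_def mult_zero_right less_irrefl)+
  have p: "p l < p (Suc l)" if "l < Suc n" for l
    using that incr[of "l - 1"] x0[of 0] x0[of "n - 1"] xL[of "n - 1"] n
    by (auto simp: p_def)
  have d: "0 < d l" if "l < Suc n" for l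
    using that P[of "l - 1"] P[of l] n by (auto simp: d_def add_pos_pos)
  have step: "d l \<le> s * (-1) ^ l * (u (p (Suc l)) - u (p l))" if "l < Suc n" for l
    using that u n by (cases l) (auto simp: d_def p_def P_def algebra_simps)
  \<comment> \<open>\<open>P l\<close> gets weight \<open>(n - l) / n\<close> at index
    \<open>l\<close> and \<open>(l + 1) / n\<close> at index \<open>l + 1\<close>, in total
    \<open>(n + 1) / n\<close>. At both ends the missing neighbour has weight
    \<open>0\<close>.\<close>
  have ln_d: "(real l / n) * ln (P (l - 1)) + (real (n - l) / n) * ln (P l) \<le> ln (d l)"
    if "l < Suc n" for l
  proof (cases "l = 0 \<or> l = n")
    case False
    then have "real (n - l) / n = 1 - real l / n"
      using that by (simp add: of_nat_diff diff_divide_distrib)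
    then show ?thesis
      using ln_add_ge_mean[of "P (l - 1)" "P l" "real l / n"] P[of l] P[of "l - 1"] that False
      by (auto simp: d_def)
  qed (use n in \<open>auto simp: d_def\<close>)
  have "real (Suc n) * T = (real (Suc n) / n) * (real n * T)"
    using n by simp
  also have "\<dots> \<le> (real (Suc n) / n) * (\<Sum>l<n. ln (P l))"
    using T by (intro mult_left_mono) (auto simp: P_def)
  also have "\<dots> = (\<Sum>l<n. (real (Suc l) / n) * ln (P l) + (real (n - l) / n) * ln (P l))"
    unfolding sum_distrib_left
    by (intro sum.cong) (auto simp: of_nat_diff simp flip: distrib_right add_divide_distrib)
  also have "\<dots> = (\<Sum>l<Suc n. (real l / n) * ln (P (l - 1))) + (\<Sum>l<Suc n. (real (n - l) / n) * ln (P l))"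
    by (subst sum.lessThan_Suc_shift) (simp add: sum.distrib)
  also have "\<dots> \<le> (\<Sum>l<Suc n. ln (d l))"
    using ln_d unfolding sum.distrib[symmetric] by (intro sum_mono) simp
  finally have sum_d: "real (Suc n) * T \<le> (\<Sum>l<Suc n. ln (d l))" .
  have "p (Suc n) \<le> L" by (simp add: p_def)
  have "\<forall>l<Suc n. p l < p (Suc l)" "p (Suc n) \<le> L" "\<forall>l<Suc n. 0 < d l"
    "\<forall>l<Suc n. d l \<le> s * (-1) ^ l * (u (p (Suc l)) - u (p l))"
    using \<open>p (Suc n) \<le> L\<close> p d step by simp_all
  from chain_lift[OF s this] obtain y where "chain (dif u) (L - 1) (Suc n) s y"
    "(\<Sum>l<Suc n. ln (d l)) + real (Suc n) * ln (real (Suc n) / real L)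
      \<le> (\<Sum>l<Suc n. ln (s * (-1) ^ l * dif u (y l)))" by (elim exE conjE)
  moreover from this(2) sum_d have "real (Suc n) * (T + ln (real (Suc n) / real L))
      \<le> (\<Sum>l<Suc n. ln (s * (-1) ^ l * dif u (y l)))"
    unfolding distrib_left by linarith
  ultimately show ?thesis by iprover
qed

text \<open>Without endpoint zeros, \<open>m + 1\<close> points leave only \<open>m\<close> jumps,
  and the first jump has the opposite sign. The weights \<open>(m - l) / (m + 1)\<close> and
  \<open>(l + 1) / (m + 1)\<close> count every old value \<open>m / (m + 1)\<close> times, so the
  mean logarithm changes only by the loss from the gaps.\<close>

lemma chain_shrink:
  assumes m: "0 < m" and c: "chain u L (Suc m) s x"
    and T: "real (Suc m) * T \<le> (\<Sum>l<Suc m. ln (s * (-1) ^ l * u (x l)))"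
  shows "\<exists>y. chain (dif u) (L - 1) m (- s) y \<and>
    real m * (T + ln (real m / real L)) \<le> (\<Sum>l<m. ln (- s * (-1) ^ l * dif u (y l)))"
proof -
  define P where "P l = s * (-1) ^ l * u (x l)" for l
  define d where "d l = P l + P (Suc l)" for l
  have s: "\<bar>- s\<bar> = 1" and incr: "\<And>l. l < m \<Longrightarrow> x l < x (Suc l)"
    and xL: "x m \<le> L" and P: "\<And>l. l < Suc m \<Longrightarrow> 0 < P l"
    using c unfolding chain_def P_def by auto
  have d: "0 < d l" if "l < m" for l
    using that P[of "Suc l"] P[of l] by (auto simp: d_def add_pos_pos)
  have step: "d l \<le> - s * (-1) ^ l * (u (x (Suc l)) - u (x l))" if "l < m" for l
    by (simp add: d_def P_def algebra_simps)
  have ln_d: "(real (m - l) / Suc m) * ln (P l) + (real (Suc l) / Suc m) * ln (P (Suc l)) \<le> ln (d l)"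
    if "l < m" for l
  proof -
    have "real (Suc l) / Suc m = 1 - real (m - l) / Suc m"
      using that by (simp add: of_nat_diff field_simps)
    then show ?thesis
      using ln_add_ge_mean[of "P l" "P (Suc l)" "real (m - l) / Suc m"] P[of l] P[of "Suc l"] that
      by (auto simp: d_def)
  qed
  have "real m * T = (real m / Suc m) * (real (Suc m) * T)"
    by simp
  also have "\<dots> \<le> (real m / Suc m) * (\<Sum>l<Suc m. ln (P l))"
    using T by (intro mult_left_mono) (auto simp: P_def)
  also have "\<dots> = (\<Sum>l<Suc m. (real (m - l) / Suc m) * ln (P l) + (real l / Suc m) * ln (P l))"
    unfolding sum_distrib_left
    by (intro sum.cong) (auto simp: of_nat_diff simp flip: distrib_right add_divide_distrib)
  also have "\<dots> = (\<Sum>l<Suc m. (real (m - l) / Suc m) * ln (P l)) + (\<Sum>l<Suc m. (real l / Suc m) * ln (P l))"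
    by (rule sum.distrib)
  also have "(\<Sum>l<Suc m. (real (m - l) / Suc m) * ln (P l)) = (\<Sum>l<m. (real (m - l) / Suc m) * ln (P l))"
    by simp
  also have "(\<Sum>l<Suc m. (real l / Suc m) * ln (P l)) = (\<Sum>l<m. (real (Suc l) / Suc m) * ln (P (Suc l)))"
    by (subst sum.lessThan_Suc_shift) simp
  also have "(\<Sum>l<m. (real (m - l) / Suc m) * ln (P l)) + \<dots> \<le> (\<Sum>l<m. ln (d l))"
    using ln_d unfolding sum.distrib[symmetric] by (intro sum_mono) simp
  finally have sum_d: "real m * T \<le> (\<Sum>l<m. ln (d l))" .
  have "\<forall>l<m. x l < x (Suc l)" "x (m) \<le> L" "\<forall>l<m. 0 < d l"
    "\<forall>l<m. d l \<le> - s * (-1) ^ l * (u (x (Suc l)) - u (x l))"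
    using incr xL d step by simp_all
  from chain_lift[OF s this] obtain y where "chain (dif u) (L - 1) m (- s) y"
    "(\<Sum>l<m. ln (d l)) + real m * ln (real m / real L)
      \<le> (\<Sum>l<m. ln (- s * (-1) ^ l * dif u (y l)))" by (elim exE conjE)
  moreover from this(2) sum_d have "real m * (T + ln (real m / real L))
      \<le> (\<Sum>l<m. ln (- s * (-1) ^ l * dif u (y l)))"
    unfolding distrib_left by linarith
  ultimately show ?thesis by iprover
qed

text \<open>
  Descartes' rule for the basis \<open>k choose i\<close>: differencing shifts the coefficients; a vanishing
  zeroth coefficient supplies an endpoint zero that saves the length of the chain.
\<close>

lemma discrete_descartes:
  assumes "finite I" "\<And>i. i \<notin> I \<Longrightarrow> c i = 0" "chain (bsum c) L n s x"
  shows "n \<le> card I"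
proof -
  from assms(1) obtain d where "I \<subseteq> {..<d}"
    unfolding finite_nat_set_iff_bounded by (metis lessThan_iff subsetI)
  with assms show ?thesis
  proof (induction d arbitrary: I c L n s x)
    case 0
    then have "c = (\<lambda>i. 0)" by auto
    with 0 show ?case by (cases n) (auto simp: chain_def)
  next
    case (Suc d)
    define I' where "I' = {i. Suc i \<in> I}"
    have I_eq: "I = Suc ` I' \<union> (I \<inter> {0})"
      by (auto simp: I'_def image_iff) (metis not0_implies_Suc)
    have I': "finite I'" "I' \<subseteq> {..<d}"
      using Suc.prems(1,4) by (auto simp: I'_def intro: finite_vimageI[of I Suc, unfolded vimage_def])
    have c': "c (Suc i) = 0" if "i \<notin> I'" for i
      using that Suc.prems(2) by (simp add: I'_def)
    have card_I: "card I = card I' + card (I \<inter> {0})"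
      by (subst I_eq, subst card_Un_disjoint) (use I' in \<open>auto simp: card_image\<close>)
    show ?case
    proof (cases "0 \<in> I")
      case True
      then have card_I: "card I = Suc (card I')"
        using card_I by simp
      show ?thesis
      proof (cases "n \<le> 1")
        case False
        then obtain m where m: "n = Suc m" "0 < m" by (cases n) auto
        \<comment> \<open>Only the signs matter here; choosing the mean for \<open>T\<close> makes
          the size condition trivial.\<close>
        define T where "T = (\<Sum>l<Suc m. ln (s * (-1) ^ l * bsum c (x l))) / Suc m"
        have "real (Suc m) * T \<le> (\<Sum>l<Suc m. ln (s * (-1) ^ l * bsum c (x l)))"
          by (simp add: T_def del: sum.lessThan_Suc)
        from chain_shrink[OF m(2) Suc.prems(3)[unfolded m(1)] this]
        obtain y where "chain (bsum (\<lambda>i. c (Suc i))) (L - 1) m (- s) y"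
          unfolding dif_bsum by iprover
        from Suc.IH[OF I'(1) c' this I'(2)] show ?thesis
          using card_I m by simp
      qed (use card_I in simp)
    next
      case False
      then have "bsum c 0 = 0" using Suc.prems(2) by simp
      define P where "P l = s * (-1) ^ l * bsum c (x l)" for l
      \<comment> \<open>With \<open>0\<close> adjoined there are \<open>n + 1\<close> nodes, so the
        differenced chain keeps \<open>n\<close> points.\<close>
      define p where "p l = (if l = 0 then 0 else x (l - 1))" for l
      define d where "d l = (if l = 0 then 0 else P (l - 1)) + P l" for l
      have s: "\<bar>s\<bar> = 1" and incr: "\<And>l. Suc l < n \<Longrightarrow> x l < x (Suc l)"
        and xL: "\<And>l. l < n \<Longrightarrow> x l \<le> L" and P: "\<And>l. l < n \<Longrightarrow> 0 < P l"
        using Suc.prems(3) unfolding chain_def P_def by auto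
      have "0 < x 0" if "0 < n"
        using P[OF that] \<open>bsum c 0 = 0\<close> by (cases "x 0") (auto simp: P_def)
      then have 1: "\<forall>l<n. p l < p (Suc l)"
        using incr by (auto simp: p_def gr0_conv_Suc)
      have 2: "p n \<le> L"
        using xL[of "n - 1"] by (simp add: p_def)
      have 3: "\<forall>l<n. 0 < d l"
        using P by (auto simp: d_def intro!: add_pos_pos)
      have 4: "\<forall>l<n. d l \<le> s * (-1) ^ l * (bsum c (p (Suc l)) - bsum c (p l))"
      proof (intro allI impI)
        fix l assume "l < n"
        show "d l \<le> s * (-1) ^ l * (bsum c (p (Suc l)) - bsum c (p l))"
          using \<open>bsum c 0 = 0\<close> by (cases l) (auto simp: d_def p_def P_def algebra_simps)
      qed
      from chain_lift[OF s 1 2 3 4]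
      obtain y where "chain (bsum (\<lambda>i. c (Suc i))) (L - 1) n s y"
        unfolding dif_bsum by (elim exE conjE)
      from Suc.IH[OF I'(1) c' this I'(2)] show ?thesis
        using card_I by simp
    qed
  qed
qed

text \<open>
  Deleting a bad point together with a neighbour preserves the alternation; the equation relating
  \<open>s'\<close> and \<open>s\<close> records that the next expected sign is unchanged.
\<close>

lemma chain_prune:
  assumes "\<bar>s\<bar> = 1" "\<And>i j. i < j \<Longrightarrow> j < n \<Longrightarrow> x i < x j" "\<And>l. l < n \<Longrightarrow> x l \<le> L"
    and "finite Q" "\<And>l. l < n \<Longrightarrow> l \<notin> Q \<Longrightarrow> 0 < s * (-1) ^ l * w (x l)"
  shows "\<exists>n' s' x'. chain w L n' s' x' \<and> n \<le> n' + 2 * card (Q \<inter> {..<n}) \<and>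
    s' * (-1) ^ n' = s * (-1) ^ n \<and> (\<forall>l<n'. \<exists>j<n. x' l = x j)"
  using assms(2,3,5)
proof (induction n)
  case 0
  then show ?case using assms(1) by (auto simp: chain_def intro!: exI[of _ 0] exI[of _ s])
next
  case (Suc n)
  have "\<exists>n' s' x'. chain w L n' s' x' \<and> n \<le> n' + 2 * card (Q \<inter> {..<n}) \<and>
      s' * (-1) ^ n' = s * (-1) ^ n \<and> (\<forall>l<n'. \<exists>j<n. x' l = x j)"
    by (rule Suc.IH) (use Suc.prems in auto)
  then obtain n' s' x' where IH: "chain w L n' s' x'" "n \<le> n' + 2 * card (Q \<inter> {..<n})"
      "s' * (-1) ^ n' = s * (-1) ^ n" "\<forall>l<n'. \<exists>j<n. x' l = x j"
    by (elim exE conjE)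
  show ?case
  proof (cases "n \<in> Q")
    case False
    have "chain w L (Suc n') s' (x'(n' := x n))"
      using IH(1) Suc.prems(2)[of n] Suc.prems(3)[of n] Suc.prems(1)[of _ n] IH(3,4) False
      by (auto simp: chain_def less_Suc_eq)
    moreover have "Q \<inter> {..<Suc n} = Q \<inter> {..<n}"
      using False by (auto simp: less_Suc_eq)
    moreover have "\<forall>l<Suc n'. \<exists>j<Suc n. (x'(n' := x n)) l = x j"
      using IH(4) by (auto simp: less_Suc_eq)
    ultimately show ?thesis
      using IH by (intro exI[of _ "Suc n'"] exI[of _ s'] exI[of _ "x'(n' := x n)"])
        (simp del: fun_upd_apply)
  next
    case True
    have "Q \<inter> {..<Suc n} = insert n (Q \<inter> {..<n})"
      using True by (auto simp: less_Suc_eq)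
    then have card: "card (Q \<inter> {..<Suc n}) = Suc (card (Q \<inter> {..<n}))"
      by simp
    show ?thesis
    proof (cases n')
      case 0
      \<comment> \<open>There is no neighbour to delete; flipping the start sign of the empty chain
        keeps the next expected sign.\<close>
      then show ?thesis
        using IH card by (intro exI[of _ 0] exI[of _ "- s'"] exI[of _ x']) (auto simp: chain_def)
    next
      case (Suc m)
      then show ?thesis
        using IH card by (intro exI[of _ m] exI[of _ s'] exI[of _ x'])
          (auto simp: chain_def less_Suc_eq)
    qed
  qed
qed

lemma chain_strict_mono:
  assumes "chain u L n s x" "i < j" "j < n"
  shows "x i < x j"
proof -
  have "x i + (j - i) \<le> x j"
    by (rule steps_less_mono[of "n - 1"]) (use assms in \<open>auto simp: chain_def\<close>)
  then show ?thesis using assms(2) by linarith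
qed

lemma power_le_fact_exp:
  fixes x :: real
  assumes "0 \<le> x"
  shows "x ^ n \<le> fact n * exp x"
proof -
  have "(\<Sum>k\<in>{n}. x ^ k /\<^sub>R fact k) \<le> exp x"
    unfolding exp_def by (rule sum_le_suminf[OF summable_exp_generic]) (use assms in auto)
  then show ?thesis by (simp add: field_simps)
qed

text \<open>The ratios multiply to \<open>(2 * M) ^ J / fact J\<close>, a single term of the
  exponential series at \<open>2 * M\<close>.\<close>

lemma sum_ln_div_le:
  assumes "0 < M"
  shows "(\<Sum>i<J. ln (2 * real M / real (Suc i))) \<le> 2 * real M"
proof -
  have "(\<Sum>i<J. ln (2 * real M / real (Suc i))) = ln ((2 * real M) ^ J / fact J)"
  proof (induction J)
    case (Suc J)
    have "(2 * real M) ^ Suc J / fact (Suc J) = (2 * real M) ^ J / fact J * (2 * real M / real (Suc J))"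
      by (simp add: field_simps)
    also have "ln \<dots> = ln ((2 * real M) ^ J / fact J) + ln (2 * real M / real (Suc J))"
      using assms by (intro ln_mult_pos) auto
    finally show ?case using Suc.IH by simp
  qed simp
  also have "\<dots> \<le> ln (exp (2 * real M))"
    using power_le_fact_exp[of "2 * real M" J] assms
    by (intro ln_mono) (auto simp: field_simps)
  finally show ?thesis by simp
qed

text \<open>
  Rows outside \<open>E\<close> have zero endpoints and lengthen the chain, rows in \<open>E\<close> shorten it. Row \<open>i\<close>
  costs \<open>ln (2 * M / (i + 1))\<close> on average, because the chain has at least \<open>(i + 1) / 2\<close> points on an interval
  of length at most \<open>M\<close>; the total cost is linear in \<open>M\<close>.
\<close>

lemma chain_rows:
  assumes J: "J \<le> M"
    and zero: "\<forall>j<J. j \<notin> E \<longrightarrow> (dif ^^ j) u 0 = 0 \<and> (dif ^^ j) u (M - j) = 0"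
    and sparse: "\<forall>j\<le>J. 8 * card (E \<inter> {..<j}) \<le> j"
    and k: "k \<le> M" "u k \<noteq> 0" and "j \<le> J"
  shows "\<exists>n s y. chain ((dif ^^ j) u) (M - j) n s y \<and> n + 2 * card (E \<inter> {..<j}) = Suc j \<and>
    real n * (ln \<bar>u k\<bar> - (\<Sum>i<j. ln (2 * real M / real (Suc i))))
      \<le> (\<Sum>l<n. ln (s * (-1) ^ l * (dif ^^ j) u (y l)))"
  using \<open>j \<le> J\<close>
proof (induction j)
  case 0
  have "chain u M 1 (sgn (u k)) (\<lambda>l. k)"
    using k by (auto simp: chain_def sgn_real_def)
  moreover have "sgn (u k) * u k = \<bar>u k\<bar>"
    by (simp add: abs_sgn)
  ultimately show ?case by (intro exI[of _ 1] exI[of _ "sgn (u k)"] exI[of _ "\<lambda>l. k"]) simp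
next
  case (Suc j)
  define T where "T = ln \<bar>u k\<bar> - (\<Sum>i<j. ln (2 * real M / real (Suc i)))"
  have "\<exists>n s y. chain ((dif ^^ j) u) (M - j) n s y \<and> n + 2 * card (E \<inter> {..<j}) = Suc j \<and>
    real n * T \<le> (\<Sum>l<n. ln (s * (-1) ^ l * (dif ^^ j) u (y l)))"
    unfolding T_def by (rule Suc.IH) (use Suc.prems in simp)
  then obtain n s y where c: "chain ((dif ^^ j) u) (M - j) n s y"
    and n: "n + 2 * card (E \<inter> {..<j}) = Suc j"
    and sum: "real n * T \<le> (\<Sum>l<n. ln (s * (-1) ^ l * (dif ^^ j) u (y l)))"
    by (elim exE conjE)
  have dif_Suc: "dif ((dif ^^ j) u) = (dif ^^ Suc j) u" "M - j - 1 = M - Suc j"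
    by simp_all
  have T_Suc: "T - ln (2 * real M / real (Suc j)) =
      ln \<bar>u k\<bar> - (\<Sum>i<Suc j. ln (2 * real M / real (Suc i)))"
    by (simp add: T_def)
  have lower: "real n' * (T - ln (2 * real M / real (Suc j))) \<le> real n' * (T + ln (real n' / real (M - j)))"
    if "Suc j \<le> 2 * n'" for n'
  proof -
    have M: "0 < M - j" using Suc.prems J by simp
    have "real (Suc j) * real (M - j) \<le> real (2 * n') * real M"
      using that by (intro mult_mono) auto
    then have "real (Suc j) / (2 * real M) \<le> real n' / real (M - j)"
      using M by (simp add: field_simps)
    then have "ln (real (Suc j) / (2 * real M)) \<le> ln (real n' / real (M - j))"
      using M by (intro ln_mono) auto
    moreover have "ln (real (Suc j) / (2 * real M)) = - ln (2 * real M / real (Suc j))"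
      using M by (subst (1 2) ln_divide_pos) auto
    ultimately show ?thesis by (intro mult_left_mono) auto
  qed
  show ?case
  proof (cases "j \<in> E")
    case False
    have card: "E \<inter> {..<Suc j} = E \<inter> {..<j}"
      using False by (auto simp: less_Suc_eq)
    \<comment> \<open>Since \<open>n = j + 1 - 2 * card (E \<inter> {..<j})\<close>, sparsity keeps
      \<open>n\<close> at least \<open>3 * j / 4 + 1\<close>.\<close>
    have sp: "8 * card (E \<inter> {..<j}) \<le> j" using sparse Suc.prems by simp
    have z: "(dif ^^ j) u 0 = 0" "(dif ^^ j) u (M - j) = 0"
      using zero Suc.prems False by auto
    have "0 < n" using n sp by linarith
    from chain_grow[OF z this c sum] obtain y' where y':
      "chain ((dif ^^ Suc j) u) (M - Suc j) (Suc n) s y'"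
      "real (Suc n) * (T + ln (real (Suc n) / real (M - j)))
        \<le> (\<Sum>l<Suc n. ln (s * (-1) ^ l * (dif ^^ Suc j) u (y' l)))"
      unfolding dif_Suc by (elim exE conjE)
    moreover have "Suc j \<le> 2 * Suc n"
      using n sp unfolding mult_Suc_right by linarith
    ultimately have "real (Suc n) * (T - ln (2 * real M / real (Suc j)))
        \<le> (\<Sum>l<Suc n. ln (s * (-1) ^ l * (dif ^^ Suc j) u (y' l)))"
      using lower[of "Suc n"] by linarith
    moreover have "Suc n + 2 * card (E \<inter> {..<Suc j}) = Suc (Suc j)"
      using n card by simp
    ultimately show ?thesis unfolding T_Suc using y'(1) by iprover
  next
    case True
    have "E \<inter> {..<Suc j} = insert j (E \<inter> {..<j})"
      using True by (auto simp: less_Suc_eq)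
    then have card: "card (E \<inter> {..<Suc j}) = Suc (card (E \<inter> {..<j}))"
      by simp
    have sp: "8 * Suc (card (E \<inter> {..<j})) \<le> Suc j" using sparse Suc.prems card by fastforce
    have "2 \<le> n" using n sp unfolding mult_Suc_right by linarith
    then obtain m where m: "n = Suc m" "0 < m" by (cases n) auto
    from chain_shrink[OF m(2) c[unfolded m(1)] sum[unfolded m(1)]] obtain y' where y':
      "chain ((dif ^^ Suc j) u) (M - Suc j) m (- s) y'"
      "real m * (T + ln (real m / real (M - j)))
        \<le> (\<Sum>l<m. ln (- s * (-1) ^ l * (dif ^^ Suc j) u (y' l)))"
      unfolding dif_Suc by (elim exE conjE)
    moreover have "Suc j \<le> 2 * m"
      using n sp m unfolding mult_Suc_right by linarith
    ultimately have "real m * (T - ln (2 * real M / real (Suc j)))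
        \<le> (\<Sum>l<m. ln (- s * (-1) ^ l * (dif ^^ Suc j) u (y' l)))"
      using lower[of m] by linarith
    moreover have "m + 2 * card (E \<inter> {..<Suc j}) = Suc (Suc j)"
      using n m card by simp
    ultimately show ?thesis unfolding T_Suc using y'(1) by iprover
  qed
qed

section \<open>Sparse rows\<close>

text \<open>
  The data at the two ends of the rows outside \<open>E\<close> can be made exactly zero by changing the sequence
  near its two ends only.
\<close>

lemma sparse_binomial_endpoints:
  assumes "0 \<le> \<theta>" "2 * J \<le> M"
    and f: "\<And>i. i \<le> M \<Longrightarrow> i \<notin> E \<Longrightarrow> \<bar>f i\<bar> \<le> \<theta>"
    and d: "\<And>j. j < J \<Longrightarrow> j \<notin> E \<Longrightarrow> \<bar>(dif ^^ j) (bsum f) (M - j)\<bar> \<le> \<theta>"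
  shows "\<exists>u. (\<forall>k\<le>M. \<bar>u k - bsum f k\<bar> \<le> 2 ^ J * \<theta>) \<and>
    (\<forall>j<J. j \<notin> E \<longrightarrow> (dif ^^ j) u 0 = 0 \<and> (dif ^^ j) u (M - j) = 0)"
proof -
  \<comment> \<open>\<open>V\<close> is the reversed sequence. \<open>cl\<close> and
    \<open>cr\<close> are the Newton coefficients at the left and right end with the small ones,
    outside \<open>E\<close>, replaced by \<open>0\<close>. As \<open>2 * J \<le> M\<close>, the two
    modified ends do not meet.\<close>
  define V where "V k = bsum f (M - k)" for k
  define cl where "cl i = (if i \<in> E then f i else 0)" for i
  define cr where "cr i = (if i \<in> E then (dif ^^ i) V 0 else 0)" for i
  define u where "u k = (if k < J then bsum cl k else if M - J < k then bsum cr (M - k) else bsum f k)" for k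
  have V: "\<bar>(dif ^^ j) V 0\<bar> \<le> \<theta>" if "j < J" "j \<notin> E" for j
    using d[OF that] dif_pow_reflect[of 0 j M "bsum f"] that assms(2)
    by (simp add: V_def[abs_def] abs_mult)
  have "\<bar>u k - bsum f k\<bar> \<le> 2 ^ J * \<theta>" if "k \<le> M" for k
  proof -
    consider "k < J" | "\<not> k < J" "M - J < k" | "\<not> k < J" "\<not> M - J < k" by blast
    then show ?thesis
    proof cases
      case 1
      have "\<bar>bsum cl k - bsum f k\<bar> \<le> 2 ^ k * \<theta>"
        unfolding bsum_diff
        by (rule bsum_le) (use f 1 that assms(1,2) in \<open>auto simp: cl_def\<close>)
      also have "\<dots> \<le> 2 ^ J * \<theta>"
        using 1 assms(1) by (intro mult_right_mono power_increasing) auto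
      finally show ?thesis using 1 by (simp add: u_def)
    next
      case 2
      have "bsum f k = V (M - k)" using that by (simp add: V_def)
      also have "\<dots> = bsum (\<lambda>i. (dif ^^ i) V 0) (M - k)"
        by (rule bsum_newton)
      finally have eq: "bsum f k = bsum (\<lambda>i. (dif ^^ i) V 0) (M - k)" .
      have "\<bar>bsum cr (M - k) - bsum f k\<bar> \<le> 2 ^ (M - k) * \<theta>"
        unfolding eq bsum_diff
        by (rule bsum_le) (use V 2 that assms(1,2) in \<open>auto simp: cr_def\<close>)
      also have "\<dots> \<le> 2 ^ J * \<theta>"
        using 2 assms(1) by (intro mult_right_mono power_increasing) auto
      finally show ?thesis using 2 by (simp add: u_def)
    next
      case 3
      then show ?thesis using assms(1) by (simp add: u_def)
    qed
  qed
  moreover have "(dif ^^ j) u 0 = 0 \<and> (dif ^^ j) u (M - j) = 0" if "j < J" "j \<notin> E" for j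
  proof
    have "(dif ^^ j) u 0 = (dif ^^ j) (bsum cl) 0"
      using that by (intro dif_pow_cong) (simp add: u_def)
    then show "(dif ^^ j) u 0 = 0"
      using that by (simp add: dif_pow_bsum cl_def)
    have "(dif ^^ j) u (M - j) = (dif ^^ j) (\<lambda>k. bsum cr (M - k)) (M - j)"
      using that assms(2) by (intro dif_pow_cong) (auto simp: u_def)
    also have "\<dots> = (-1) ^ j * (dif ^^ j) (bsum cr) 0"
      using that assms(2) dif_pow_reflect[of "M - j" j M "bsum cr"] by simp
    also have "\<dots> = 0"
      using that by (simp add: dif_pow_bsum cr_def)
    finally show "(dif ^^ j) u (M - j) = 0" .
  qed
  ultimately show ?thesis by blast
qed

text \<open>Markov's inequality: the deficits \<open>A + M - X l\<close> are nonnegative and average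
  at most \<open>3 * M\<close>, while a small term has deficit above \<open>30 * M + 29\<close>. The
  constant 29 settles the case \<open>M = 0\<close>.\<close>

lemma few_small_terms:
  fixes X :: "nat \<Rightarrow> real"
  assumes sum: "real n * (A - 2 * real M) \<le> (\<Sum>l<n. X l)"
    and upper: "\<And>l. l < n \<Longrightarrow> X l \<le> A + real M"
  shows "10 * card {l. l < n \<and> X l < A - 29 * (real M + 1)} \<le> n"
proof -
  define Q where "Q = {l. l < n \<and> X l < A - 29 * (real M + 1)}"
  have "(\<Sum>l<n. X l) \<le> (\<Sum>l<n. A + real M - (if l \<in> Q then 30 * real M + 29 else 0))"
    using upper by (intro sum_mono) (auto simp: Q_def)
  also have "\<dots> = real n * (A + real M) - real (card Q) * (30 * real M + 29)"
    by (simp add: sum_subtractf sum.If_cases Int_def Q_def lessThan_def conj_commute)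
  finally have "real (card Q) * (30 * real M + 29) \<le> 3 * real n * real M"
    using sum by (simp add: algebra_simps)
  then have "10 * real (card Q) * (3 * real M) + 29 * real (card Q) \<le> real n * (3 * real M)"
    by (simp add: algebra_simps)
  then have le: "10 * real (card Q) * (3 * real M) \<le> real n * (3 * real M)"
    using of_nat_0_le_iff[of "card Q"] by linarith
  have z: "M = 0 \<Longrightarrow> card Q = 0"
    using \<open>10 * real (card Q) * (3 * real M) + 29 * real (card Q) \<le> real n * (3 * real M)\<close> by simp
  have "10 * card Q \<le> n"
  proof (cases "M = 0")
    case False
    then have "10 * real (card Q) \<le> real n"
      using le by simp
    then show ?thesis by linarith
  next
    case True
    then show ?thesis using z by simp
  qed
  then show ?thesis by (simp add: Q_def)
qed

text \<open>
  If \<open>bsum f\<close> were large, the chain in row \<open>J\<close> would have more than \<open>card E\<close> points on which the row is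
  not negligible, whereas the row is negligibly close to a binomial sum with at most \<open>card E\<close>
  coefficients.
\<close>

lemma sparse_core:
  assumes "0 \<le> \<theta>" "2 * J \<le> M" "finite E"
    and sparse: "\<forall>j\<le>J. 8 * card (E \<inter> {..<j}) \<le> j" "5 * card E < 3 * J + 4"
    and f: "\<And>i. i \<le> M \<Longrightarrow> i \<notin> E \<Longrightarrow> \<bar>f i\<bar> \<le> \<theta>"
    and d: "\<And>j. j < J \<Longrightarrow> j \<notin> E \<Longrightarrow> \<bar>(dif ^^ j) (bsum f) (M - j)\<bar> \<le> \<theta>"
    and "k \<le> M"
  shows "\<bar>bsum f k\<bar> \<le> exp (32 * (real M + 1)) * \<theta>"
proof -
  obtain u where u: "\<And>k. k \<le> M \<Longrightarrow> \<bar>u k - bsum f k\<bar> \<le> 2 ^ J * \<theta>"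
    and zero: "\<forall>j<J. j \<notin> E \<longrightarrow> (dif ^^ j) u 0 = 0 \<and> (dif ^^ j) u (M - j) = 0"
    using sparse_binomial_endpoints[of \<theta> J M E f] assms by blast
  \<comment> \<open>The chain starts at the maximum of \<open>\<bar>u\<bar>\<close>, which also
    bounds all later chain values from above, as the averaging argument requires.\<close>
  obtain k0 where k0: "k0 \<le> M" "\<And>k. k \<le> M \<Longrightarrow> \<bar>u k\<bar> \<le> \<bar>u k0\<bar>"
  proof -
    have "Max ((\<lambda>k. \<bar>u k\<bar>) ` {..M}) \<in> (\<lambda>k. \<bar>u k\<bar>) ` {..M}"
      by (rule Max_in) auto
    then obtain k0 where k0: "Max ((\<lambda>k. \<bar>u k\<bar>) ` {..M}) = \<bar>u k0\<bar>" "k0 \<in> {..M}"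
      by (rule imageE)
    show thesis
    proof (rule that)
      show "\<bar>u k\<bar> \<le> \<bar>u k0\<bar>" if "k \<le> M" for k
        unfolding k0(1)[symmetric] by (rule Max_ge) (use that in auto)
    qed (use k0 in simp)
  qed
  define S where "S = \<bar>u k0\<bar>"
  have pow2: "(2::real) ^ J \<le> 2 ^ M" "(2::real) ^ M \<le> 4 ^ M" "(2::real) ^ J * 2 ^ J \<le> 2 ^ M"
    using assms(2) by (auto simp: power_mono power_increasing simp flip: power_add)
  have main: "S \<le> exp (29 * (real M + 1)) * (2 * 4 ^ M * \<theta>)"
  proof (rule ccontr)
    assume "\<not> ?thesis"
    then have big: "exp (29 * (real M + 1)) * (2 * 4 ^ M * \<theta>) < S" by simp
    moreover have "0 \<le> exp (29 * (real M + 1)) * (2 * 4 ^ M * \<theta>)"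
      using assms(1) by simp
    ultimately have S: "0 < S" by linarith
    then have "u k0 \<noteq> 0" by (auto simp: S_def)
    define D where "D = (dif ^^ J) u"
    define A where "A = ln S"
    have "J \<le> M" using assms(2) by simp
    from chain_rows[OF this zero sparse(1) k0(1) \<open>u k0 \<noteq> 0\<close> order.refl]
    obtain n s y where c: "chain D (M - J) n s y"
      and n: "n + 2 * card (E \<inter> {..<J}) = Suc J"
      and sum: "real n * (A - (\<Sum>i<J. ln (2 * real M / real (Suc i))))
        \<le> (\<Sum>l<n. ln (s * (-1) ^ l * D (y l)))"
      unfolding D_def A_def S_def by (elim exE conjE)
    have s: "\<bar>s\<bar> = 1" and yM: "\<And>l. l < n \<Longrightarrow> y l \<le> M - J"
      and pos: "\<And>l. l < n \<Longrightarrow> 0 < s * (-1) ^ l * D (y l)"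
      using c unfolding chain_def by auto
    have abs_eq: "s * (-1) ^ l * D (y l) = \<bar>D (y l)\<bar>" if "l < n" for l
    proof -
      have "\<bar>s * (-1) ^ l * D (y l)\<bar> = \<bar>D (y l)\<bar>"
        using s by (simp add: abs_mult)
      then show ?thesis using pos[OF that] by linarith
    qed
    have "(\<Sum>i<J. ln (2 * real M / real (Suc i))) \<le> 2 * real M"
      using sum_ln_div_le[of M J] \<open>J \<le> M\<close> by (cases "M = 0") auto
    then have "real n * (A - 2 * real M) \<le> real n * (A - (\<Sum>i<J. ln (2 * real M / real (Suc i))))"
      by (intro mult_left_mono) auto
    with sum have sum': "real n * (A - 2 * real M) \<le> (\<Sum>l<n. ln (s * (-1) ^ l * D (y l)))"
      by linarith
    have upper: "ln (s * (-1) ^ l * D (y l)) \<le> A + real M" if "l < n" for l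
    proof -
      have "\<bar>D (y l)\<bar> \<le> 2 ^ J * S"
        unfolding D_def S_def by (rule dif_pow_le) (use k0(2) yM[OF that] \<open>J \<le> M\<close> in auto)
      then have "ln (s * (-1) ^ l * D (y l)) \<le> ln (2 ^ J * S)"
        unfolding abs_eq[OF that] using pos[OF that] abs_eq[OF that] by (intro ln_mono) auto
      also have "\<dots> = A + real J * ln 2"
        using S by (simp add: A_def ln_mult ln_realpow)
      also have "real J * ln 2 \<le> real M * 1"
        using ln_2_less_1 \<open>J \<le> M\<close> by (intro mult_mono) auto
      finally show ?thesis by simp
    qed
    define Q where "Q = {l. l < n \<and> ln (s * (-1) ^ l * D (y l)) < A - 29 * (real M + 1)}"
    have Q: "10 * card Q \<le> n" "finite Q"
      unfolding Q_def by (rule few_small_terms[OF sum' upper]) simp_all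
    \<comment> \<open>Row \<open>J\<close> of the transform of \<open>f\<close>, keeping only the
      coefficients with index in \<open>E\<close>.\<close>
    define w where "w = bsum (\<lambda>i. if i + J \<in> E then f (i + J) else 0)"
    \<comment> \<open>Two errors: passing from \<open>u\<close> to \<open>bsum f\<close>, amplified
      by \<open>J\<close> differences, and dropping the coefficients outside \<open>E\<close>. By
      \<open>big\<close> their sum is smaller than every chain value outside
      \<open>Q\<close>.\<close>
    have near: "\<bar>D k - w k\<bar> \<le> 2 * 4 ^ M * \<theta>" if "k \<le> M - J" for k
    proof -
      have "\<bar>D k - (dif ^^ J) (bsum f) k\<bar> \<le> 2 ^ J * (2 ^ J * \<theta>)"
        unfolding D_def by (rule dif_pow_diff_le) (use u that \<open>J \<le> M\<close> in auto)
      moreover have "\<bar>(dif ^^ J) (bsum f) k - w k\<bar> \<le> 2 ^ k * \<theta>"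
        unfolding dif_pow_bsum w_def bsum_diff
        by (rule bsum_le) (use f that \<open>J \<le> M\<close> assms(1) in auto)
      moreover have "2 ^ J * (2 ^ J * \<theta>) \<le> 4 ^ M * \<theta>"
        using mult_right_mono[OF order.trans[OF pow2(3,2)] assms(1)] by (simp add: mult.assoc)
      moreover have "2 ^ k * \<theta> \<le> 4 ^ M * \<theta>"
      proof (intro mult_right_mono)
        have "(2::real) ^ k \<le> 2 ^ M" using that by (intro power_increasing) auto
        then show "(2::real) ^ k \<le> 4 ^ M" using pow2(2) by linarith
      qed (rule assms(1))
      ultimately show ?thesis by linarith
    qed
    have w: "0 < s * (-1) ^ l * w (y l)" if "l < n" "l \<notin> Q" for l
    proof -
      have "A - 29 * (real M + 1) \<le> ln \<bar>D (y l)\<bar>"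
        using that abs_eq[OF that(1)] by (simp add: Q_def not_less)
      then have "exp (A - 29 * (real M + 1)) \<le> \<bar>D (y l)\<bar>"
        using pos[OF that(1)] abs_eq[OF that(1)] by (metis exp_le_cancel_iff exp_ln)
      moreover have "2 * 4 ^ M * \<theta> < exp (A - 29 * (real M + 1))"
        using big S by (simp add: A_def exp_diff field_simps)
      moreover have "\<bar>s * (-1) ^ l * D (y l) - s * (-1) ^ l * w (y l)\<bar> = \<bar>D (y l) - w (y l)\<bar>"
        using s by (simp add: abs_mult flip: right_diff_distrib)
      ultimately show ?thesis
        using near[OF yM[OF that(1)]] abs_eq[OF that(1)] by linarith
    qed
    have "\<exists>n' s' x'. chain w (M - J) n' s' x' \<and> n \<le> n' + 2 * card (Q \<inter> {..<n}) \<and>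
      s' * (-1) ^ n' = s * (-1) ^ n \<and> (\<forall>l<n'. \<exists>j<n. x' l = y j)"
      by (rule chain_prune[OF s]) (use chain_strict_mono[OF c] yM Q(2) w in auto)
    then obtain n' s' x' where c': "chain w (M - J) n' s' x'" and "n \<le> n' + 2 * card (Q \<inter> {..<n})"
      by (elim exE conjE)
    moreover have "Q \<inter> {..<n} = Q" by (auto simp: Q_def)
    ultimately have n': "n \<le> n' + 2 * card Q" by simp
    have "n' \<le> card {i. i + J \<in> E}"
      using c' unfolding w_def
      by (rule discrete_descartes[rotated 2])
         (use finite_vimageI[OF assms(3), of "\<lambda>i. i + J"] in \<open>auto simp: vimage_def inj_def\<close>)
    also have "\<dots> \<le> card E"
      by (rule card_inj_on_le[of "\<lambda>i. i + J"]) (use assms(3) in auto)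
    finally have "n' \<le> card E" .
    \<comment> \<open>Pruning loses at most \<open>n / 5\<close> points, so
      \<open>4 * n / 5 \<le> card E\<close>; sparsity of the rows gives
      \<open>4 * n \<ge> 3 * J + 4\<close>. This is the origin of the bound on \<open>card E\<close>
      in the hypotheses.\<close>
    then have "4 * n \<le> 5 * card E"
      using n' Q(1) by linarith
    moreover have "3 * J + 4 \<le> 4 * n"
      using n sparse(1)[rule_format, of J] by simp
    ultimately show False using sparse(2) by linarith
  qed
  have e: "2 \<le> exp (1::real)"
    using exp_ge_add_one_self[of 1] by simp
  then have e2: "(2::real) ^ M \<le> exp (real M)"
    using power_mono[OF e, of M] by (simp flip: exp_of_nat_mult)
  then have e4: "(4::real) ^ M \<le> exp (2 * real M)"
    using power_mono[OF e2, of 2] by (simp flip: exp_of_nat_mult power_mult add: mult.commute[of M] power_mult)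
  have "\<bar>bsum f k\<bar> \<le> S + 2 ^ J * \<theta>"
    using u[OF \<open>k \<le> M\<close>] k0(2)[OF \<open>k \<le> M\<close>] by (simp add: S_def)
  also have "\<dots> \<le> (exp (29 * (real M + 1)) * (2 * 4 ^ M) + 2 ^ M) * \<theta>"
    using main mult_right_mono[OF pow2(1) assms(1)] by (simp add: algebra_simps)
  also have "\<dots> \<le> exp (32 * (real M + 1)) * \<theta>"
  proof (rule mult_right_mono[OF _ assms(1)])
    have "exp (29 * (real M + 1)) * (2 * 4 ^ M) \<le> exp (29 * (real M + 1)) * (exp 1 * exp (2 * real M))"
      using e e4 by (intro mult_left_mono mult_mono) auto
    also have "\<dots> = exp (31 * real M + 30)"
      by (simp flip: exp_add add: algebra_simps)
    finally have "exp (29 * (real M + 1)) * (2 * 4 ^ M) + 2 ^ M \<le> exp (31 * real M + 30) + exp (31 * real M + 30)"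
      using e2 by (smt (verit) exp_le_cancel_iff of_nat_0_le_iff)
    also have "\<dots> \<le> exp 1 * exp (31 * real M + 30)"
      using mult_right_mono[OF e, of "exp (31 * real M + 30)"] by simp
    also have "\<dots> = exp (31 * real M + 31)" by (simp flip: exp_add)
    also have "\<dots> \<le> exp (32 * (real M + 1))" by simp
    finally show "exp (29 * (real M + 1)) * (2 * 4 ^ M) + 2 ^ M \<le> exp (32 * (real M + 1))" .
  qed
  finally show ?thesis .
qed

text \<open>Otherwise every start up to \<open>B\<close> begins an interval filled by
  \<open>E\<close> to more than one eighth. Laying such intervals end to end from \<open>0\<close>
  until they pass \<open>B\<close> yields more than \<open>B / 8\<close> elements of
  \<open>E\<close>.\<close>

lemma exists_sparse_start:
  assumes "finite E" "8 * card E \<le> B"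
  shows "\<exists>b\<le>B. \<forall>j. 8 * card (E \<inter> {b..<b + j}) \<le> j"
proof (rule ccontr)
  assume "\<not> ?thesis"
  then have dense: "\<exists>j. j < 8 * card (E \<inter> {b..<b + j})" if "b \<le> B" for b
    using that by (fastforce simp: not_le)
  have cover: "\<exists>b'>B. b' \<le> b + 8 * card (E \<inter> {b..<b'})" if "b \<le> B" for b
    using that
  proof (induction "B - b" arbitrary: b rule: less_induct)
    case less
    obtain j where j: "j < 8 * card (E \<inter> {b..<b + j})"
      using dense less.prems by blast
    then have "0 < j" by (cases j) auto
    show ?case
    proof (cases "B < b + j")
      case True
      then show ?thesis using j by (intro exI[of _ "b + j"]) simp
    next
      case False
      then obtain b' where b': "B < b'" "b' \<le> b + j + 8 * card (E \<inter> {b + j..<b'})"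
        using less.hyps[of "b + j"] \<open>0 < j\<close> by (metis diff_less_mono2 less_add_same_cancel1 not_less order.strict_trans2)
      have "E \<inter> {b..<b'} = (E \<inter> {b..<b + j}) \<union> (E \<inter> {b + j..<b'})"
        using False b' by auto
      then have "card (E \<inter> {b..<b'}) = card (E \<inter> {b..<b + j}) + card (E \<inter> {b + j..<b'})"
        using assms(1) by (simp add: card_Un_disjoint Int_assoc disjoint_iff)
      then show ?thesis using b' j by (intro exI[of _ b']) simp
    qed
  qed
  obtain b' where "B < b'" "b' \<le> 8 * card (E \<inter> {0..<b'})"
    using cover[of 0] by auto
  moreover have "card (E \<inter> {0..<b'}) \<le> card E"
    using assms(1) by (intro card_mono) auto
  ultimately show False using assms(2) by linarith
qed

text \<open>\<open>E\<close> may be dense near \<open>0\<close>. The argument therefore restarts at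
  a row \<open>b\<close> from which \<open>E\<close> is sparse on every initial window, and the
  remaining \<open>a - b\<close> differences cost a factor \<open>2 ^ (a - b)\<close>.\<close>

lemma sparse_row_small:
  assumes "0 \<le> \<theta>" "finite E" "a \<le> M" "64 * card E < a + 1"
    and f: "\<And>j. j \<le> M \<Longrightarrow> j \<notin> E \<Longrightarrow> \<bar>f j\<bar> \<le> \<theta>"
    and d: "\<And>j. j \<le> M \<Longrightarrow> j \<notin> E \<Longrightarrow> \<bar>(dif ^^ j) (bsum f) (M - j)\<bar> \<le> \<theta>"
    and "k \<le> M - a"
  shows "\<bar>(dif ^^ a) (bsum f) k\<bar> \<le> exp (33 * (real M + 1)) * \<theta>"
proof -
  have "8 * card E \<le> a div 2" using assms(4) by linarith
  then obtain b where b: "b \<le> a div 2" "\<And>j. 8 * card (E \<inter> {b..<b + j}) \<le> j"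
    using exists_sparse_start[OF assms(2)] by blast
  \<comment> \<open>Together with \<open>b \<le> a div 2\<close> this leaves room for
    \<open>2 * J \<le> M - b\<close>.\<close>
  define J where "J = a div 4"
  define E' where "E' = {i. i + b \<in> E}"
  have bM: "b \<le> M" "b \<le> a" using b assms(3) by linarith+
  have fin: "finite E'"
    using finite_vimageI[OF assms(2), of "\<lambda>i. i + b"] by (simp add: E'_def vimage_def inj_def)
  have shift: "card (E' \<inter> {..<j}) \<le> card (E \<inter> {b..<b + j})" for j
    by (rule card_inj_on_le[of "\<lambda>i. i + b"]) (use assms(2) in \<open>auto simp: E'_def\<close>)
  have "card E' \<le> card E"
    by (rule card_inj_on_le[of "\<lambda>i. i + b"]) (use assms(2) in \<open>auto simp: E'_def\<close>)
  then have "5 * card E' < 3 * J + 4"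
    using assms(4) unfolding J_def by linarith
  have sp: "\<forall>j\<le>J. 8 * card (E' \<inter> {..<j}) \<le> j"
    using shift b(2) by (meson le_trans mult_le_mono2)
  have base: "\<bar>(dif ^^ b) (bsum f) i\<bar> \<le> exp (32 * (real (M - b) + 1)) * \<theta>" if "i \<le> M - b" for i
    unfolding dif_pow_bsum
  proof (rule sparse_core[OF assms(1) _ fin sp \<open>5 * card E' < 3 * J + 4\<close> _ _ that])
    show "2 * J \<le> M - b" using b(1) assms(3) unfolding J_def by linarith
  next
    fix j assume "j < J" "j \<notin> E'"
    moreover have "(dif ^^ j) (bsum (\<lambda>i. f (i + b))) (M - b - j) = (dif ^^ (j + b)) (bsum f) (M - (j + b))"
      by (simp add: dif_pow_bsum add.assoc add.commute[of b] diff_diff_eq)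
    ultimately show "\<bar>(dif ^^ j) (bsum (\<lambda>i. f (i + b))) (M - b - j)\<bar> \<le> \<theta>"
      using d[of "j + b"] b(1) assms(3) by (simp add: E'_def J_def)
  qed (use f bM in \<open>auto simp: E'_def\<close>)
  have "(dif ^^ a) (bsum f) k = (dif ^^ (a - b)) ((dif ^^ b) (bsum f)) k"
    using bM by (simp flip: funpow_add o_apply[of "dif ^^ (a - b)"])
  also have "\<bar>\<dots>\<bar> \<le> 2 ^ (a - b) * (exp (32 * (real (M - b) + 1)) * \<theta>)"
    by (rule dif_pow_le) (use base assms(3,7) bM in auto)
  also have "\<dots> \<le> exp (real M) * (exp (32 * (real M + 1)) * \<theta>)"
  proof (intro mult_mono)
    have "2 \<le> exp (1::real)" using exp_ge_add_one_self[of 1] by simp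
    then have "2 ^ (a - b) \<le> exp (real (a - b))"
      using power_mono[of 2 "exp (1::real)" "a - b"] by (simp flip: exp_of_nat_mult)
    also have "\<dots> \<le> exp (real M)" using assms(3) by simp
    finally show "2 ^ (a - b) \<le> exp (real M)" .
  qed (use assms(1) in auto)
  also have "\<dots> = exp (real M + 32 * (real M + 1)) * \<theta>"
    by (simp only: exp_add mult.assoc)
  also have "\<dots> \<le> exp (33 * (real M + 1)) * \<theta>"
    using assms(1) by (intro mult_right_mono) auto
  finally show ?thesis .
qed

section \<open>Three variables\<close>

text \<open>Solving the exact recurrence for \<open>h (Suc k) j\<close> gives the differenced
  transform of \<open>h 0\<close>. The error doubles and grows by \<open>\<epsilon>\<close> in each
  step, hence the factor \<open>2 ^ k - 1\<close>.\<close>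

lemma triangle_expansion:
  assumes rec: "\<And>k j. k + j < N \<Longrightarrow> \<bar>h k j + h (Suc k) j + h k (Suc j)\<bar> \<le> \<epsilon>"
    and "k + j \<le> N"
  shows "\<bar>h k j - (-1) ^ k * (dif ^^ j) (bsum (h 0)) k\<bar> \<le> (2 ^ k - 1) * \<epsilon>"
  using assms(2)
proof (induction k arbitrary: j)
  case 0
  then show ?case by (simp add: dif_pow_bsum)
next
  case (Suc k)
  define F where "F j = (-1) ^ k * (dif ^^ j) (bsum (h 0)) k" for j
  have 1: "\<bar>h k j - F j\<bar> \<le> (2 ^ k - 1) * \<epsilon>" and 2: "\<bar>h k (Suc j) - F (Suc j)\<bar> \<le> (2 ^ k - 1) * \<epsilon>"
    using Suc.IH[of j] Suc.IH[of "Suc j"] Suc.prems unfolding F_def by auto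
  have "(dif ^^ j) (bsum (h 0)) (Suc k) = (dif ^^ Suc j) (bsum (h 0)) k + (dif ^^ j) (bsum (h 0)) k"
    by (simp add: dif_pow_Suc del: funpow.simps)
  then have "(-1) ^ Suc k * (dif ^^ j) (bsum (h 0)) (Suc k) = - F (Suc j) - F j"
    by (simp add: F_def algebra_simps del: funpow.simps)
  moreover have "(2 ^ Suc k - 1) * \<epsilon> = \<epsilon> + (2 ^ k - 1) * \<epsilon> + (2 ^ k - 1) * \<epsilon>"
    by (simp add: algebra_simps)
  moreover have "\<bar>h k j + h (Suc k) j + h k (Suc j)\<bar> \<le> \<epsilon>"
    using rec Suc.prems by simp
  ultimately show ?case using 1 2 by linarith
qed

text \<open>The counted \<open>j\<close> are the exceptional rows: if they were few,
  \<open>sparse_row_small\<close> would make row \<open>a\<close> small. The base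
  \<open>exp 40\<close> absorbs its constant 33 and the factors \<open>2 ^ N\<close>.\<close>

lemma triangle_facets:
  fixes h :: "nat \<Rightarrow> nat \<Rightarrow> real"
  assumes rec: "\<And>k j. k + j < N \<Longrightarrow> \<bar>h k j + h (Suc k) j + h k (Suc j)\<bar> \<le> \<theta>"
    and "p + a \<le> N" and large: "exp 40 ^ Suc N * \<theta> \<le> \<bar>h p a\<bar>" and "0 < \<theta>"
  shows "a + 1 \<le> 64 * card {j. j \<le> N \<and> (\<theta> \<le> \<bar>h 0 j\<bar> \<or> \<theta> \<le> \<bar>h (N - j) j\<bar>)}"
proof (rule ccontr)
  define E where "E = {j. j \<le> N \<and> (\<theta> \<le> \<bar>h 0 j\<bar> \<or> \<theta> \<le> \<bar>h (N - j) j\<bar>)}"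
  assume "\<not> ?thesis"
  then have card: "64 * card E < a + 1" by (simp add: E_def)
  have fin: "finite E" by (simp add: E_def)
  have exp: "\<bar>h k j - (-1) ^ k * (dif ^^ j) (bsum (h 0)) k\<bar> \<le> 2 ^ N * \<theta>" if "k + j \<le> N" for k j
  proof -
    have "(2::real) ^ k - 1 \<le> 2 ^ N"
      by (rule order.trans[of _ "2 ^ k"]) (use power_increasing[of k N "2::real"] that in auto)
    then have "(2 ^ k - 1) * \<theta> \<le> 2 ^ N * \<theta>"
      using \<open>0 < \<theta>\<close> by (intro mult_right_mono) auto
    then show ?thesis using triangle_expansion[of N h \<theta> k j] rec that by fastforce
  qed
  have pow: "1 \<le> (2::real) ^ N" by simp
  have "\<bar>(dif ^^ a) (bsum (h 0)) p\<bar> \<le> exp (33 * (real N + 1)) * (2 * 2 ^ N * \<theta>)"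
  proof (rule sparse_row_small[OF _ fin _ card])
    fix j assume j: "j \<le> N" "j \<notin> E"
    have "\<theta> \<le> 2 ^ N * \<theta>"
      using mult_right_mono[OF pow, of \<theta>] \<open>0 < \<theta>\<close> by simp
    have small: "\<bar>h 0 j\<bar> < \<theta>" "\<bar>h (N - j) j\<bar> < \<theta>"
      using j by (auto simp: E_def)
    moreover have "\<bar>(-1) ^ (N - j) * (dif ^^ j) (bsum (h 0)) (N - j)\<bar> = \<bar>(dif ^^ j) (bsum (h 0)) (N - j)\<bar>"
      by (simp add: abs_mult)
    moreover have "\<bar>h (N - j) j - (-1) ^ (N - j) * (dif ^^ j) (bsum (h 0)) (N - j)\<bar> \<le> 2 ^ N * \<theta>"
      using exp[of "N - j" j] j by simp
    ultimately show "\<bar>(dif ^^ j) (bsum (h 0)) (N - j)\<bar> \<le> 2 * 2 ^ N * \<theta>"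
      using \<open>\<theta> \<le> 2 ^ N * \<theta>\<close> by linarith
    show "\<bar>h 0 j\<bar> \<le> 2 * 2 ^ N * \<theta>"
      using \<open>\<theta> \<le> 2 ^ N * \<theta>\<close> \<open>0 < \<theta>\<close> small by linarith
  qed (use assms in auto)
  moreover have "\<bar>(-1) ^ p * (dif ^^ a) (bsum (h 0)) p\<bar> = \<bar>(dif ^^ a) (bsum (h 0)) p\<bar>"
    by (simp add: abs_mult)
  ultimately have "\<bar>h p a\<bar> \<le> (exp (33 * (real N + 1)) * (2 * 2 ^ N) + 2 ^ N) * \<theta>"
    using exp[of p a] assms(2) by (simp add: algebra_simps)
  also have "\<dots> < exp 40 ^ Suc N * \<theta>"
  proof (rule mult_strict_right_mono[OF _ \<open>0 < \<theta>\<close>])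
    have e: "2 \<le> exp (1::real)" using exp_ge_add_one_self[of 1] by simp
    have e2: "2 * 2 ^ N \<le> exp (real N + 1)"
      using power_mono[of 2 "exp (1::real)" "Suc N"] e by (simp add: exp_add mult.commute flip: exp_of_nat_mult)
    have "exp (33 * (real N + 1)) * (2 * 2 ^ N) \<le> exp (33 * (real N + 1)) * exp (real N + 1)"
      using e2 by (intro mult_left_mono) auto
    also have "\<dots> = exp (34 * (real N + 1))" by (simp flip: exp_add)
    finally have e34: "exp (33 * (real N + 1)) * (2 * 2 ^ N) \<le> exp (34 * (real N + 1))" .
    have "exp (33 * (real N + 1)) * (2 * 2 ^ N) + 2 ^ N < exp (34 * (real N + 1)) + exp (34 * (real N + 1))"
    proof -
      have "exp (real N + 1) \<le> exp (34 * (real N + 1))" by simp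
      then show ?thesis using e2 e34 pow by linarith
    qed
    also have "\<dots> \<le> exp 1 * exp (34 * (real N + 1))"
      using mult_right_mono[OF e, of "exp (34 * (real N + 1))"] by simp
    also have "\<dots> = exp (34 * (real N + 1) + 1)" by (simp flip: exp_add)
    also have "\<dots> \<le> exp (40 * real (Suc N))" by simp
    also have "\<dots> = exp 40 ^ Suc N"
      by (metis exp_of_nat_mult mult.commute)
    finally show "exp (33 * (real N + 1)) * (2 * 2 ^ N) + 2 ^ N < exp 40 ^ Suc N" .
  qed
  finally show False using large by simp
qed

section \<open>Merging two variables\<close>

text \<open>The index set is arbitrary because merging removes variables.\<close>

definition lattice :: "nat set \<Rightarrow> nat \<Rightarrow> (nat \<Rightarrow> nat) set" where
  "lattice V N = {\<alpha>. (\<forall>i. i \<notin> V \<longrightarrow> \<alpha> i = 0) \<and> sum \<alpha> V = N}"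

text \<open>Writing \<open>N = Suc M\<close> makes the condition void for \<open>N = 0\<close> and
  avoids truncated subtraction.\<close>

definition small_sums :: "nat set \<Rightarrow> nat \<Rightarrow> real \<Rightarrow> ((nat \<Rightarrow> nat) \<Rightarrow> real) \<Rightarrow> bool" where
  "small_sums V N \<epsilon> g \<longleftrightarrow>
     (\<forall>M. N = Suc M \<longrightarrow> (\<forall>\<beta>\<in>lattice V M. \<bar>\<Sum>i\<in>V. g (\<beta>(i := Suc (\<beta> i)))\<bar> \<le> \<epsilon>))"

text \<open>
  Substituting \<open>x\<^sub>z + x\<^sub>r\<close> for \<open>x\<^sub>z\<close>: the variable \<open>r\<close> is eliminated after its exponent has been
  lowered by \<open>e\<close>. The recurrence is inherited on \<open>V - {r}\<close>, and large values lift back to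
  points whose \<open>r\<close>-coordinate is at least \<open>e\<close>.
\<close>

definition merge :: "nat \<Rightarrow> nat \<Rightarrow> nat \<Rightarrow> ((nat \<Rightarrow> nat) \<Rightarrow> real) \<Rightarrow> (nat \<Rightarrow> nat) \<Rightarrow> real" where
  "merge z r e g \<gamma> = bsum (\<lambda>i. g (\<gamma>(r := e + i, z := \<gamma> z - i))) (\<gamma> z)"

lemma exists_max_bound:
  fixes f :: "nat \<Rightarrow> real"
  assumes "\<And>\<eta>. (\<And>m. m \<le> n \<Longrightarrow> \<bar>f m\<bar> \<le> \<eta>) \<Longrightarrow> X \<le> D * \<eta>"
  shows "\<exists>m\<le>n. X \<le> D * \<bar>f m\<bar>"
proof -
  have "Max ((\<lambda>m. \<bar>f m\<bar>) ` {..n}) \<in> (\<lambda>m. \<bar>f m\<bar>) ` {..n}"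
    by (rule Max_in) auto
  then obtain m where m: "Max ((\<lambda>m. \<bar>f m\<bar>) ` {..n}) = \<bar>f m\<bar>" "m \<in> {..n}"
    by (rule imageE)
  have "\<bar>f k\<bar> \<le> \<bar>f m\<bar>" if "k \<le> n" for k
    unfolding m(1)[symmetric] by (rule Max_ge) (use that in auto)
  then show ?thesis using assms[of "\<bar>f m\<bar>"] m(2) by blast
qed

lemma lattice_le:
  assumes "finite V" "\<alpha> \<in> lattice V N"
  shows "\<alpha> i \<le> N"
proof (cases "i \<in> V")
  case True
  then show ?thesis using member_le_sum[of i V \<alpha>] assms by (simp add: lattice_def)
qed (use assms in \<open>simp add: lattice_def\<close>)

lemma small_sums_mono: "small_sums V N \<epsilon> g \<Longrightarrow> \<epsilon> \<le> \<epsilon>' \<Longrightarrow> small_sums V N \<epsilon>' g"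
  unfolding small_sums_def using order.trans by blast

lemma sum_remove_two:
  fixes f :: "nat \<Rightarrow> 'b :: comm_monoid_add"
  assumes "finite V" "z \<in> V" "z \<noteq> r"
  shows "sum f (V - {r}) = f z + sum f (V - {z, r})"
proof -
  have "V - {r} - {z} = V - {z, r}" by blast
  then show ?thesis using assms sum.remove[of "V - {r}" z f] by simp
qed

lemma sum_two_apart:
  fixes f :: "nat \<Rightarrow> 'b :: comm_monoid_add"
  assumes "finite V" "z \<in> V" "r \<in> V" "z \<noteq> r"
  shows "sum f V = f z + (f r + sum f (V - {z, r}))"
  using assms sum.remove[of V r f] sum_remove_two[of V z r f] by (simp add: ac_simps)

lemma sum_fun_upd_two:
  fixes f :: "nat \<Rightarrow> nat"
  assumes "finite V" "z \<in> V" "r \<in> V" "z \<noteq> r"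
  shows "sum (f(r := x, z := y)) V = x + y + sum f (V - {z, r})"
  using sum_two_apart[OF assms, of "f(r := x, z := y)"] assms(4) by simp

lemma merge_lift_mem:
  assumes "finite V" "z \<in> V" "r \<in> V" "z \<noteq> r" "\<gamma> \<in> lattice (V - {r}) M" "i \<le> \<gamma> z"
  shows "\<gamma>(r := e + i, z := \<gamma> z - i) \<in> lattice V (M + e)"
proof -
  have "sum \<gamma> (V - {r}) = \<gamma> z + sum \<gamma> (V - {z, r})"
    using assms by (intro sum_remove_two)
  then show ?thesis
    using assms sum_fun_upd_two[OF assms(1-4), of \<gamma> "e + i" "\<gamma> z - i"]
    by (auto simp: lattice_def)
qed

text \<open>By Pascal's rule, raising \<open>\<gamma> z\<close> splits into raising \<open>z\<close>
  and raising \<open>r\<close> in each lifted point, so the merged sum is the binomial sum of the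
  original ones.\<close>

lemma small_sums_merge:
  assumes V: "finite V" "z \<in> V" "r \<in> V" "z \<noteq> r" and "0 \<le> \<epsilon>"
    and small: "small_sums V N \<epsilon> g"
  shows "small_sums (V - {r}) (N - e) (2 ^ N * \<epsilon>) (merge z r e g)"
  unfolding small_sums_def
proof (intro allI impI ballI)
  fix M \<gamma> assume N: "N - e = Suc M" and \<gamma>: "\<gamma> \<in> lattice (V - {r}) M"
  define k where "k = \<gamma> z"
  have "k \<le> M" unfolding k_def by (rule lattice_le[OF _ \<gamma>]) (use V in simp)
  define \<beta> where "\<beta> i = \<gamma>(r := e + i, z := k - i)" for i
  have \<beta>: "\<beta> i \<in> lattice V (M + e)" if "i \<le> k" for i
    unfolding \<beta>_def k_def by (rule merge_lift_mem[OF V \<gamma>]) (use that in \<open>simp add: k_def\<close>)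
  define S where "S i = (\<Sum>l\<in>V. g ((\<beta> i)(l := Suc (\<beta> i l))))" for i
  have S: "\<bar>S i\<bar> \<le> \<epsilon>" if "i \<le> k" for i
    using small \<beta>[OF that] N unfolding small_sums_def S_def by (metis Suc_diff_le add_Suc add.commute diff_is_0_eq' le_add_diff_inverse2 nat_le_linear old.nat.distinct(2))
  have z: "merge z r e g (\<gamma>(z := Suc (\<gamma> z)))
      = bsum (\<lambda>i. g ((\<beta> i)(z := Suc (\<beta> i z))) + g ((\<beta> i)(r := Suc (\<beta> i r)))) k"
  proof -
    have "merge z r e g (\<gamma>(z := Suc (\<gamma> z)))
        = (\<Sum>i\<le>Suc k. real (Suc k choose i) * g (\<gamma>(r := e + i, z := Suc k - i)))"
      using V by (simp add: merge_def bsum_def k_def fun_upd_twist del: sum.atMost_Suc)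
    also have "\<dots> = bsum (\<lambda>i. g (\<gamma>(r := e + i, z := Suc k - i)) + g (\<gamma>(r := e + Suc i, z := Suc k - Suc i))) k"
      unfolding binomial_sum_Suc bsum_def by simp
    also have "\<dots> = bsum (\<lambda>i. g ((\<beta> i)(z := Suc (\<beta> i z))) + g ((\<beta> i)(r := Suc (\<beta> i r)))) k"
      unfolding bsum_def
    proof (intro sum.cong refl arg_cong2[of _ _ _ _ "(*)"] arg_cong2[of _ _ _ _ "(+)"] arg_cong[of _ _ g])
      fix i assume "i \<in> {..k}"
      then show "\<gamma>(r := e + i, z := Suc k - i) = (\<beta> i)(z := Suc (\<beta> i z))"
        by (simp add: \<beta>_def Suc_diff_le)
      show "\<gamma>(r := e + Suc i, z := Suc k - Suc i) = (\<beta> i)(r := Suc (\<beta> i r))"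
        using V by (auto simp: \<beta>_def)
    qed
    finally show ?thesis .
  qed
  have other: "merge z r e g (\<gamma>(l := Suc (\<gamma> l))) = bsum (\<lambda>i. g ((\<beta> i)(l := Suc (\<beta> i l)))) k"
    if "l \<in> V - {z, r}" for l
  proof -
    have "(\<gamma>(l := Suc (\<gamma> l)))(r := e + i, z := k - i) = (\<beta> i)(l := Suc (\<beta> i l))" for i
      using that by (auto simp: \<beta>_def)
    then show ?thesis
      using that by (simp add: merge_def k_def)
  qed
  have "(\<Sum>l\<in>V - {r}. merge z r e g (\<gamma>(l := Suc (\<gamma> l)))) = bsum S k"
  proof -
    have "(\<Sum>l\<in>V - {r}. merge z r e g (\<gamma>(l := Suc (\<gamma> l))))
        = merge z r e g (\<gamma>(z := Suc (\<gamma> z))) + (\<Sum>l\<in>V - {z, r}. merge z r e g (\<gamma>(l := Suc (\<gamma> l))))"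
      using V by (intro sum_remove_two)
    also have "(\<Sum>l\<in>V - {z, r}. merge z r e g (\<gamma>(l := Suc (\<gamma> l))))
        = (\<Sum>l\<in>V - {z, r}. bsum (\<lambda>i. g ((\<beta> i)(l := Suc (\<beta> i l)))) k)"
      using other by (intro sum.cong) auto
    also have "\<dots> = bsum (\<lambda>i. \<Sum>l\<in>V - {z, r}. g ((\<beta> i)(l := Suc (\<beta> i l)))) k"
      unfolding bsum_def by (subst sum.swap) (simp add: sum_distrib_left)
    also have "merge z r e g (\<gamma>(z := Suc (\<gamma> z))) + \<dots> = bsum S k"
      unfolding z S_def sum_two_apart[OF V] by (simp add: bsum_def sum.distrib algebra_simps)
    finally show ?thesis .
  qed
  also have "\<bar>\<dots>\<bar> \<le> 2 ^ k * \<epsilon>"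
    using S by (rule bsum_le)
  also have "\<dots> \<le> 2 ^ N * \<epsilon>"
    using \<open>k \<le> M\<close> N \<open>0 \<le> \<epsilon>\<close> by (intro mult_right_mono power_increasing) auto
  finally show "\<bar>\<Sum>l\<in>V - {r}. merge z r e g (\<gamma>(l := Suc (\<gamma> l)))\<bar> \<le> 2 ^ N * \<epsilon>" .
qed

text \<open>Some binomial term carries the value up to the factor \<open>2 ^ N\<close>. The bound
  \<open>i \<le> \<gamma> z\<close> is essential later: if \<open>\<gamma> z = 0\<close>, the lift
  has \<open>r\<close>-coordinate exactly \<open>e\<close> and \<open>z\<close> still
  vanishes.\<close>

lemma merge_lift_large:
  assumes V: "finite V" "z \<in> V" "r \<in> V" "z \<noteq> r" and \<gamma>: "\<gamma> \<in> lattice (V - {r}) (N - e)"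
    and "e \<le> N" and large: "2 ^ N * \<theta> \<le> \<bar>merge z r e g \<gamma>\<bar>" and "0 \<le> \<theta>"
  shows "\<exists>i\<le>\<gamma> z. \<gamma>(r := e + i, z := \<gamma> z - i) \<in> lattice V N \<and>
    \<theta> \<le> \<bar>g (\<gamma>(r := e + i, z := \<gamma> z - i))\<bar>"
proof -
  have "\<exists>i\<le>\<gamma> z. \<bar>merge z r e g \<gamma>\<bar> \<le> 2 ^ (\<gamma> z) * \<bar>g (\<gamma>(r := e + i, z := \<gamma> z - i))\<bar>"
    unfolding merge_def by (rule exists_max_bound) (rule bsum_le)
  then obtain i where i: "i \<le> \<gamma> z"
    "\<bar>merge z r e g \<gamma>\<bar> \<le> 2 ^ (\<gamma> z) * \<bar>g (\<gamma>(r := e + i, z := \<gamma> z - i))\<bar>" by blast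
  have "\<gamma> z \<le> N - e" by (rule lattice_le[OF _ \<gamma>]) (use V in simp)
  then have "2 ^ (\<gamma> z) * \<theta> \<le> 2 ^ N * \<theta>"
    using \<open>0 \<le> \<theta>\<close> by (intro mult_right_mono power_increasing) auto
  then have "2 ^ (\<gamma> z) * \<theta> \<le> 2 ^ (\<gamma> z) * \<bar>g (\<gamma>(r := e + i, z := \<gamma> z - i))\<bar>"
    using large i(2) by linarith
  then show ?thesis
    using merge_lift_mem[OF V \<gamma> i(1), of e] i(1) \<open>e \<le> N\<close> by auto
qed

text \<open>
  Merging into \<open>z\<close> could cancel the large value at \<open>a\<close>; by binomial inversion some shift \<open>e\<close> between \<open>a i\<close> and
  \<open>a i + a z\<close> preserves it.
\<close>

lemma merge_large_point:
  assumes V: "finite V" "z \<in> V" "i \<in> V" "z \<noteq> i" and a: "a \<in> lattice V N"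
  shows "\<exists>e m. a i \<le> e \<and> e \<le> N \<and> a(i := 0, z := m) \<in> lattice (V - {i}) (N - e) \<and>
    \<bar>g a\<bar> \<le> 2 ^ N * \<bar>merge z i e g (a(i := 0, z := m))\<bar>"
proof -
  \<comment> \<open>The values of \<open>g\<close> on the line through \<open>a\<close> on which the
    \<open>i\<close>- and \<open>z\<close>-coordinates have constant sum. Merging with shift
    \<open>a i + a z - m\<close> produces \<open>bsum c m\<close>.\<close>
  define c where "c s = g (a(i := a i + a z - s, z := s))" for s
  have N: "N = a i + a z + sum a (V - {z, i})"
    using a sum_two_apart[OF V, of a] by (simp add: lattice_def)
  have "\<exists>m\<le>a z. \<bar>c (a z)\<bar> \<le> 2 ^ a z * \<bar>bsum c m\<bar>"
    by (rule exists_max_bound) (rule bsum_inverse_le)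
  then obtain m where m: "m \<le> a z" "\<bar>c (a z)\<bar> \<le> 2 ^ a z * \<bar>bsum c m\<bar>" by blast
  define e where "e = a i + a z - m"
  have "merge z i e g (a(i := 0, z := m)) = (\<Sum>t\<le>m. real (m choose t) * c (m - t))"
    unfolding merge_def bsum_def
  proof (intro sum.cong)
    fix t assume "t \<in> {..m}"
    then have "t \<le> m" by simp
    then have "(a(i := 0, z := m))(i := e + t, z := (a(i := 0, z := m)) z - t)
        = a(i := a i + a z - (m - t), z := m - t)"
      using V m(1) by (auto simp: e_def)
    then show "real ((a(i := 0, z := m)) z choose t) *
        g ((a(i := 0, z := m))(i := e + t, z := (a(i := 0, z := m)) z - t))
        = real (m choose t) * c (m - t)"
      by (simp add: c_def)
  qed simp
  also have "\<dots> = bsum c m"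
    unfolding bsum_def
    by (rule sum.reindex_bij_witness[of _ "\<lambda>t. m - t" "\<lambda>t. m - t"])
       (auto simp: binomial_symmetric[symmetric])
  finally have merge: "merge z i e g (a(i := 0, z := m)) = bsum c m" .
  have "\<bar>g a\<bar> \<le> 2 ^ a z * \<bar>bsum c m\<bar>"
    using m(2) by (simp add: c_def)
  also have "\<dots> \<le> 2 ^ N * \<bar>bsum c m\<bar>"
    using N by (intro mult_right_mono power_increasing) auto
  finally have "\<bar>g a\<bar> \<le> 2 ^ N * \<bar>merge z i e g (a(i := 0, z := m))\<bar>"
    unfolding merge .
  moreover have "a(i := 0, z := m) \<in> lattice (V - {i}) (N - e)"
  proof -
    have "sum (a(i := 0, z := m)) (V - {i}) = m + sum a (V - {z, i})"
      using V sum_remove_two[of V z i "a(i := 0, z := m)"] by simp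
    then show ?thesis
      using a V m(1) N by (auto simp: lattice_def e_def)
  qed
  moreover have "a i \<le> e" "e \<le> N"
    using m(1) N by (auto simp: e_def)
  ultimately show ?thesis by blast
qed

section \<open>Large values with many prescribed coordinates\<close>

lemma triangle_lattice:
  assumes ne: "z \<noteq> y" "z \<noteq> r" "y \<noteq> r" and small: "small_sums {z, y, r} N \<theta> g"
    and a: "a \<in> lattice {z, y, r} N" and "exp 40 ^ Suc N * \<theta> \<le> \<bar>g a\<bar>" "0 < \<theta>"
  shows "\<exists>B. finite B \<and> a r + 1 \<le> 64 * card B \<and>
    (\<forall>j\<in>B. \<exists>\<alpha>\<in>lattice {z, y, r} N. \<alpha> r = j \<and> (\<alpha> z = 0 \<or> \<alpha> y = 0) \<and> \<theta> \<le> \<bar>g \<alpha>\<bar>)"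
proof -
  \<comment> \<open>In row \<open>r = j\<close> the end \<open>k = 0\<close> lies on
    \<open>z = 0\<close> and the end \<open>k = M - j\<close> on \<open>y = 0\<close>.\<close>
  define pt where "pt M k j = (\<lambda>_. 0)(z := k, y := M - j - k, r := j)" for M k j :: nat
  have mem: "pt M k j \<in> lattice {z, y, r} M" if "k + j \<le> M" for M k j
    using ne that by (auto simp: lattice_def pt_def)
  define h where "h k j = g (pt N k j)" for k j
  have "\<bar>h k j + h (Suc k) j + h k (Suc j)\<bar> \<le> \<theta>" if "k + j < N" for k j
  proof -
    have "N = Suc (N - 1)" "k + j \<le> N - 1" using that by auto
    then obtain M where M: "N = Suc M" "k + j \<le> M" by blast
    have "(pt M k j)(y := Suc (pt M k j y)) = pt N k j"
      "(pt M k j)(z := Suc (pt M k j z)) = pt N (Suc k) j"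
      "(pt M k j)(r := Suc (pt M k j r)) = pt N k (Suc j)"
      using ne M by (auto simp: pt_def fun_eq_iff)
    then have "(\<Sum>i\<in>{z, y, r}. g ((pt M k j)(i := Suc (pt M k j i)))) = h k j + h (Suc k) j + h k (Suc j)"
      using ne by (simp add: h_def)
    then show ?thesis
      using small mem[OF M(2)] M(1) unfolding small_sums_def by metis
  qed
  moreover have N: "N = a z + a y + a r"
    using a ne by (simp add: lattice_def)
  moreover have "a = pt N (a z) (a r)"
    using a ne N by (auto simp: lattice_def pt_def fun_eq_iff)
  then have "h (a z) (a r) = g a"
    by (simp add: h_def)
  ultimately have "a r + 1 \<le> 64 * card {j. j \<le> N \<and> (\<theta> \<le> \<bar>h 0 j\<bar> \<or> \<theta> \<le> \<bar>h (N - j) j\<bar>)}"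
    using assms by (intro triangle_facets[where p = "a z"]) auto
  moreover have "\<exists>\<alpha>\<in>lattice {z, y, r} N. \<alpha> r = j \<and> (\<alpha> z = 0 \<or> \<alpha> y = 0) \<and> \<theta> \<le> \<bar>g \<alpha>\<bar>"
    if "j \<le> N" "\<theta> \<le> \<bar>h 0 j\<bar> \<or> \<theta> \<le> \<bar>h (N - j) j\<bar>" for j
  proof -
    have 0: "pt N 0 j r = j" "pt N 0 j z = 0" "pt N (N - j) j r = j" "pt N (N - j) j y = 0"
      using ne that by (auto simp: pt_def)
    from that(2) show ?thesis
      using 0 mem[of 0 j N] mem[of "N - j" j N] that(1) unfolding h_def by fastforce
  qed
  ultimately show ?thesis
    by (intro exI[of _ "{j. j \<le> N \<and> (\<theta> \<le> \<bar>h 0 j\<bar> \<or> \<theta> \<le> \<bar>h (N - j) j\<bar>)}"]) auto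
qed

text \<open>Each further variable \<open>i\<close> is merged into \<open>z\<close> with a shift
  \<open>e \<ge> a i\<close> that preserves the large value, so lifting restores an
  \<open>i\<close>-coordinate of at least \<open>a i\<close>. Merging and lifting each cost
  \<open>2 ^ N\<close>, hence the step from \<open>K\<close> to \<open>4 * K\<close>. The bounds
  \<open>a i \<le> \<alpha> i\<close> allow the other variables to be treated afterwards.\<close>

lemma facet_points:
  assumes "finite R" "z \<noteq> y" "z \<noteq> r" "y \<noteq> r" "R \<inter> {z, y, r} = {}"
  shows "\<exists>K\<ge>1. \<forall>N g a \<theta>. 0 < \<theta> \<longrightarrow> small_sums ({z, y, r} \<union> R) N \<theta> g \<longrightarrow>
    a \<in> lattice ({z, y, r} \<union> R) N \<longrightarrow> K ^ Suc N * \<theta> \<le> \<bar>g a\<bar> \<longrightarrow>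
    (\<exists>B. finite B \<and> a r + 1 \<le> 64 * card B \<and>
      (\<forall>j\<in>B. \<exists>\<alpha>\<in>lattice ({z, y, r} \<union> R) N. \<alpha> r = j \<and> (\<alpha> z = 0 \<or> \<alpha> y = 0) \<and>
        (\<forall>i\<in>R. a i \<le> \<alpha> i) \<and> \<theta> \<le> \<bar>g \<alpha>\<bar>))"
  using assms(1,5)
proof (induction R rule: finite_induct)
  case empty
  show ?case
    by (intro exI[of _ "exp 40"]) (use triangle_lattice[OF assms(2-4)] in auto)
next
  case (insert i R)
  define W where "W = {z, y, r} \<union> R"
  define V where "V = {z, y, r} \<union> insert i R"
  have V: "finite V" "z \<in> V" "i \<in> V" "z \<noteq> i" and iyr: "i \<noteq> y" "i \<noteq> r" "i \<notin> R" and VW: "V - {i} = W"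
    using insert.hyps insert.prems assms by (auto simp: V_def W_def)
  obtain K :: real where K: "1 \<le> K" and IH: "\<And>N g a \<theta>. 0 < \<theta> \<Longrightarrow> small_sums W N \<theta> g \<Longrightarrow>
      a \<in> lattice W N \<Longrightarrow> K ^ Suc N * \<theta> \<le> \<bar>g a\<bar> \<Longrightarrow>
      \<exists>B. finite B \<and> a r + 1 \<le> 64 * card B \<and>
      (\<forall>j\<in>B. \<exists>\<alpha>\<in>lattice W N. \<alpha> r = j \<and> (\<alpha> z = 0 \<or> \<alpha> y = 0) \<and>
        (\<forall>i\<in>R. a i \<le> \<alpha> i) \<and> \<theta> \<le> \<bar>g \<alpha>\<bar>)"
    using insert.IH insert.prems unfolding W_def by auto
  have "\<exists>B. finite B \<and> a r + 1 \<le> 64 * card B \<and>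
      (\<forall>j\<in>B. \<exists>\<alpha>\<in>lattice V N. \<alpha> r = j \<and> (\<alpha> z = 0 \<or> \<alpha> y = 0) \<and>
        (\<forall>i\<in>insert i R. a i \<le> \<alpha> i) \<and> \<theta> \<le> \<bar>g \<alpha>\<bar>)"
    if \<theta>: "0 < \<theta>" and small: "small_sums V N \<theta> g" and a: "a \<in> lattice V N"
      and large: "(4 * K) ^ Suc N * \<theta> \<le> \<bar>g a\<bar>" for N g a and \<theta> :: real
  proof -
    obtain e m where e: "a i \<le> e" "e \<le> N" and a': "a(i := 0, z := m) \<in> lattice W (N - e)"
      and merge: "\<bar>g a\<bar> \<le> 2 ^ N * \<bar>merge z i e g (a(i := 0, z := m))\<bar>"
      using merge_large_point[OF V a] unfolding VW by blast
    have small': "small_sums W (N - e) (2 ^ N * \<theta>) (merge z i e g)"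
      using small_sums_merge[OF V _ small, of e] \<theta> unfolding VW by simp
    have "2 ^ N * (K ^ Suc (N - e) * (2 ^ N * \<theta>)) \<le> 2 ^ Suc N * (K ^ Suc N * (2 ^ Suc N * \<theta>))"
      using K \<theta> by (intro mult_mono power_increasing mult_nonneg_nonneg) auto
    also have "\<dots> = (4 * K) ^ Suc N * \<theta>"
    proof -
      have "(2::real) ^ Suc N * 2 ^ Suc N = 4 ^ Suc N"
        by (subst power_mult_distrib[symmetric]) simp
      then show ?thesis by (simp only: power_mult_distrib ac_simps)
    qed
    finally have "2 ^ N * (K ^ Suc (N - e) * (2 ^ N * \<theta>)) \<le> 2 ^ N * \<bar>merge z i e g (a(i := 0, z := m))\<bar>"
      using large merge by linarith
    then have "K ^ Suc (N - e) * (2 ^ N * \<theta>) \<le> \<bar>merge z i e g (a(i := 0, z := m))\<bar>"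
      by (rule mult_left_le_imp_le) simp
    note IH' = IH[of "2 ^ N * \<theta>" "N - e" "merge z i e g" "a(i := 0, z := m)", OF _ small' a' this]
    have "0 < 2 ^ N * \<theta>" using \<theta> by simp
    note IH'[OF this]
    moreover have "(a(i := 0, z := m)) r = a r" using iyr assms(3) by simp
    ultimately obtain B where B: "finite B" "a r + 1 \<le> 64 * card B"
      and pts: "\<forall>j\<in>B. \<exists>\<alpha>\<in>lattice W (N - e). \<alpha> r = j \<and> (\<alpha> z = 0 \<or> \<alpha> y = 0) \<and>
        (\<forall>k\<in>R. (a(i := 0, z := m)) k \<le> \<alpha> k) \<and> 2 ^ N * \<theta> \<le> \<bar>merge z i e g \<alpha>\<bar>"
      by (elim exE conjE) (simp only:)
    have "\<exists>\<alpha>\<in>lattice V N. \<alpha> r = j \<and> (\<alpha> z = 0 \<or> \<alpha> y = 0) \<and>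
        (\<forall>i\<in>insert i R. a i \<le> \<alpha> i) \<and> \<theta> \<le> \<bar>g \<alpha>\<bar>" if j: "j \<in> B" for j
    proof -
      obtain \<gamma> where \<gamma>: "\<gamma> \<in> lattice (V - {i}) (N - e)" "\<gamma> r = j" "\<gamma> z = 0 \<or> \<gamma> y = 0"
        "\<And>k. k \<in> R \<Longrightarrow> (a(i := 0, z := m)) k \<le> \<gamma> k" "2 ^ N * \<theta> \<le> \<bar>merge z i e g \<gamma>\<bar>"
        using bspec[OF pts j] unfolding VW by blast
      obtain t where t: "t \<le> \<gamma> z" "\<gamma>(i := e + t, z := \<gamma> z - t) \<in> lattice V N"
        "\<theta> \<le> \<bar>g (\<gamma>(i := e + t, z := \<gamma> z - t))\<bar>"
        using merge_lift_large[OF V \<gamma>(1) e(2) \<gamma>(5)] \<theta> by auto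
      have "z \<notin> R" using insert.prems by auto
      then have "a k \<le> \<gamma> k" if "k \<in> R" for k
        using \<gamma>(4)[OF that] that iyr by (auto split: if_splits)
      then show ?thesis
        using t \<gamma>(2,3) e iyr V assms(2,3) \<open>z \<notin> R\<close>
        by (intro bexI[of _ "\<gamma>(i := e + t, z := \<gamma> z - t)"]) auto
    qed
    then show ?thesis using B by blast
  qed
  moreover have "1 \<le> 4 * K" using K by simp
  ultimately show ?case unfolding V_def[symmetric] by (intro exI[of _ "4 * K"]) blast
qed

text \<open>
  The coordinates of \<open>b\<close> are shared between two large points, one with \<open>\<alpha> z = 0\<close> and one with
  \<open>\<alpha> y = 0\<close>. One of the two carries at least half of them, which is the origin of the exponent
  \<open>h\<^sub>0\<close>.
\<close>

definition marked :: "nat \<Rightarrow> nat \<Rightarrow> nat set \<Rightarrow> nat \<Rightarrow> real \<Rightarrow> ((nat \<Rightarrow> nat) \<Rightarrow> real) \<Rightarrow> (nat \<Rightarrow> nat) \<Rightarrow> bool" where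
  "marked z y R N \<theta> g b \<longleftrightarrow> (\<exists>U\<subseteq>R.
     (\<exists>\<alpha>\<in>lattice (insert z (insert y R)) N. \<alpha> z = 0 \<and> (\<forall>i\<in>U. \<alpha> i = b i) \<and> \<theta> \<le> \<bar>g \<alpha>\<bar>) \<and>
     (\<exists>\<alpha>\<in>lattice (insert z (insert y R)) N. \<alpha> y = 0 \<and> (\<forall>i\<in>R - U. \<alpha> i = b i) \<and> \<theta> \<le> \<bar>g \<alpha>\<bar>))"

lemma marked_sym:
  assumes "marked z y R N \<theta> g b"
  shows "marked y z R N \<theta> g b"
proof -
  obtain U where "U \<subseteq> R"
    "\<exists>\<alpha>\<in>lattice (insert z (insert y R)) N. \<alpha> z = 0 \<and> (\<forall>i\<in>U. \<alpha> i = b i) \<and> \<theta> \<le> \<bar>g \<alpha>\<bar>"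
    "\<exists>\<alpha>\<in>lattice (insert z (insert y R)) N. \<alpha> y = 0 \<and> (\<forall>i\<in>R - U. \<alpha> i = b i) \<and> \<theta> \<le> \<bar>g \<alpha>\<bar>"
    using assms unfolding marked_def by blast
  then show ?thesis
    unfolding marked_def insert_commute[of y z]
    by (intro exI[of _ "R - U"]) (simp add: double_diff)
qed

text \<open>The witness with \<open>z = 0\<close> lifts with \<open>r\<close>-coordinate exactly
  \<open>j\<close>, so \<open>r\<close> joins \<open>U\<close>. The other witness keeps
  \<open>y = 0\<close> and its coordinates in \<open>R - U\<close>.\<close>

lemma marked_lift:
  assumes "finite R" "z \<noteq> y" "r \<notin> R" "r \<noteq> z" "r \<noteq> y" "z \<notin> R" "j \<le> N" "0 \<le> \<theta>"
    and marked: "marked z y R (N - j) (2 ^ N * \<theta>) (merge z r j g) b"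
  shows "marked z y (insert r R) N \<theta> g (b(r := j))"
proof -
  define V where "V = insert z (insert y (insert r R))"
  have V: "finite V" "z \<in> V" "r \<in> V" "z \<noteq> r" and VR: "V - {r} = insert z (insert y R)"
    using assms by (auto simp: V_def)
  obtain U \<gamma> \<gamma>' where U: "U \<subseteq> R"
    and \<gamma>: "\<gamma> \<in> lattice (V - {r}) (N - j)" "\<gamma> z = 0" "\<forall>i\<in>U. \<gamma> i = b i" "2 ^ N * \<theta> \<le> \<bar>merge z r j g \<gamma>\<bar>"
    and \<gamma>': "\<gamma>' \<in> lattice (V - {r}) (N - j)" "\<gamma>' y = 0" "\<forall>i\<in>R - U. \<gamma>' i = b i" "2 ^ N * \<theta> \<le> \<bar>merge z r j g \<gamma>'\<bar>"
    using marked unfolding marked_def VR by blast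
  have "\<exists>\<alpha>\<in>lattice V N. \<alpha> z = 0 \<and> (\<forall>i\<in>insert r U. \<alpha> i = (b(r := j)) i) \<and> \<theta> \<le> \<bar>g \<alpha>\<bar>"
  proof -
    obtain i where "i \<le> \<gamma> z" "\<gamma>(r := j + i, z := \<gamma> z - i) \<in> lattice V N"
      "\<theta> \<le> \<bar>g (\<gamma>(r := j + i, z := \<gamma> z - i))\<bar>"
      using merge_lift_large[OF V \<gamma>(1) assms(7) \<gamma>(4) assms(8)] by blast
    then show ?thesis
      using \<gamma>(2,3) U assms by (intro bexI[of _ "\<gamma>(r := j + i, z := \<gamma> z - i)"]) auto
  qed
  moreover have "\<exists>\<alpha>\<in>lattice V N. \<alpha> y = 0 \<and> (\<forall>i\<in>insert r R - insert r U. \<alpha> i = (b(r := j)) i) \<and> \<theta> \<le> \<bar>g \<alpha>\<bar>"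
  proof -
    obtain i where "i \<le> \<gamma>' z" "\<gamma>'(r := j + i, z := \<gamma>' z - i) \<in> lattice V N"
      "\<theta> \<le> \<bar>g (\<gamma>'(r := j + i, z := \<gamma>' z - i))\<bar>"
      using merge_lift_large[OF V \<gamma>'(1) assms(7) \<gamma>'(4) assms(8)] by blast
    then show ?thesis
      using \<gamma>'(2,3) U assms by (intro bexI[of _ "\<gamma>'(r := j + i, z := \<gamma>' z - i)"]) auto
  qed
  ultimately show ?thesis
    unfolding marked_def V_def[symmetric] using U by (intro exI[of _ "insert r U"]) blast
qed

text \<open>For two variables the absolute value drifts by at most \<open>\<theta>\<close> per step,
  so a value of at least \<open>(N + 1) * \<theta>\<close> stays above \<open>\<theta>\<close> up to
  both ends.\<close>

lemma marked_line:
  assumes ne: "z \<noteq> y" and small: "small_sums {z, y} N \<theta> g" and a: "a \<in> lattice {z, y} N"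
    and large: "2 ^ Suc N * \<theta> \<le> \<bar>g a\<bar>" and "0 < \<theta>"
  shows "marked z y {} N \<theta> g b"
proof -
  define pt where "pt M k = (\<lambda>_. 0)(z := k, y := M - k)" for M k :: nat
  have mem: "pt M k \<in> lattice {z, y} M" if "k \<le> M" for M k
    using ne that by (auto simp: lattice_def pt_def)
  define h where "h k = g (pt N k)" for k
  have rec: "\<bar>h k + h (Suc k)\<bar> \<le> \<theta>" if "k < N" for k
  proof -
    have "N = Suc (N - 1)" "k \<le> N - 1" using that by auto
    then obtain M where M: "N = Suc M" "k \<le> M" by blast
    have "(pt M k)(y := Suc (pt M k y)) = pt N k" "(pt M k)(z := Suc (pt M k z)) = pt N (Suc k)"
      using ne M by (auto simp: pt_def fun_eq_iff)
    then have "(\<Sum>i\<in>{z, y}. g ((pt M k)(i := Suc (pt M k i)))) = h k + h (Suc k)"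
      using ne by (simp add: h_def)
    then show ?thesis
      using small mem[OF M(2)] M(1) unfolding small_sums_def by metis
  qed
  have drift: "\<bar>\<bar>h k\<bar> - \<bar>h (k + m)\<bar>\<bar> \<le> real m * \<theta>" if "k + m \<le> N" for k m
    using that
  proof (induction m)
    case (Suc m)
    then show ?case using rec[of "k + m"] by (simp add: algebra_simps)
  qed simp
  have N: "N = a z + a y"
    using a ne by (simp add: lattice_def)
  have "a = pt N (a z)"
    using a ne N by (auto simp: lattice_def pt_def fun_eq_iff)
  then have ha: "h (a z) = g a"
    by (simp add: h_def)
  have "real N + 1 \<le> 2 ^ Suc N"
    using of_nat_less_two_power[of "Suc N", where 'a = real] by simp
  then have "(real N + 1) * \<theta> \<le> \<bar>g a\<bar>"
    using large \<open>0 < \<theta>\<close> by (meson less_imp_le mult_right_mono order.trans)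
  moreover have "real (a z) * \<theta> \<le> real N * \<theta>" "real (N - a z) * \<theta> \<le> real N * \<theta>"
    using N \<open>0 < \<theta>\<close> by (auto intro!: mult_right_mono)
  ultimately have "\<theta> \<le> \<bar>h 0\<bar>" "\<theta> \<le> \<bar>h N\<bar>"
    using drift[of 0 "a z"] drift[of "a z" "N - a z"] N ha by (auto simp: algebra_simps)
  moreover have "pt N 0 z = 0" "pt N N y = 0"
    using ne by (auto simp: pt_def)
  ultimately show ?thesis
    using mem[of 0 N] mem[of N N] unfolding marked_def h_def by auto
qed

text \<open>\<open>facet_points\<close> supplies the values \<open>j\<close> for one variable
  \<open>r\<close>. For each \<open>j\<close>, merging \<open>r\<close> into the variable that
  vanishes leads to the induction hypothesis, and its patterns are extended by
  \<open>r := j\<close>.\<close>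

lemma many_marked:
  assumes "finite R" "z \<noteq> y" "z \<notin> R" "y \<notin> R"
  shows "\<exists>K\<ge>1. \<forall>N g a \<theta>. 0 < \<theta> \<longrightarrow> small_sums (insert z (insert y R)) N \<theta> g \<longrightarrow>
    a \<in> lattice (insert z (insert y R)) N \<longrightarrow> K ^ Suc N * \<theta> \<le> \<bar>g a\<bar> \<longrightarrow>
    (\<exists>\<B>. finite \<B> \<and> (\<Prod>i\<in>R. (real (a i) + 1) / 64) \<le> real (card \<B>) \<and>
      (\<forall>b\<in>\<B>. (\<forall>i. i \<notin> R \<longrightarrow> b i = 0) \<and> marked z y R N \<theta> g b))"
  using assms(1,3,4)
proof (induction R rule: finite_induct)
  case empty
  have "\<exists>\<B>. finite \<B> \<and> 1 \<le> real (card \<B>) \<and> (\<forall>b\<in>\<B>. (\<forall>i. b i = 0) \<and> marked z y {} N \<theta> g b)"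
    if "0 < \<theta>" "small_sums {z, y} N \<theta> g" "a \<in> lattice {z, y} N" "2 ^ Suc N * \<theta> \<le> \<bar>g a\<bar>"
    for N g a and \<theta> :: real
    using marked_line[OF assms(2) that(2-4,1)] by (intro exI[of _ "{\<lambda>_. 0}"]) simp
  then show ?case by (intro exI[of _ 2]) (auto simp del: power_Suc)
next
  case (insert r R)
  define W where "W = insert z (insert y R)"
  define V where "V = insert z (insert y (insert r R))"
  have V: "finite V" "z \<in> V" "y \<in> V" "r \<in> V" and ne: "z \<noteq> r" "y \<noteq> r" and VW: "V - {r} = W"
    and zyR: "z \<notin> R" "y \<notin> R"
    using insert.hyps insert.prems assms by (auto simp: V_def W_def)
  obtain K :: real where K: "1 \<le> K" and IH: "\<And>N g a \<theta>. 0 < \<theta> \<Longrightarrow> small_sums W N \<theta> g \<Longrightarrow>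
      a \<in> lattice W N \<Longrightarrow> K ^ Suc N * \<theta> \<le> \<bar>g a\<bar> \<Longrightarrow>
      \<exists>\<B>. finite \<B> \<and> (\<Prod>i\<in>R. (real (a i) + 1) / 64) \<le> real (card \<B>) \<and>
      (\<forall>b\<in>\<B>. (\<forall>i. i \<notin> R \<longrightarrow> b i = 0) \<and> marked z y R N \<theta> g b)"
    using insert.IH zyR unfolding W_def by auto
  have VU: "{z, y, r} \<union> R = V" by (auto simp: V_def)
  obtain L :: real where L: "1 \<le> L" and facets: "\<And>N g a \<theta>. 0 < \<theta> \<Longrightarrow> small_sums V N \<theta> g \<Longrightarrow>
      a \<in> lattice V N \<Longrightarrow> L ^ Suc N * \<theta> \<le> \<bar>g a\<bar> \<Longrightarrow>
      \<exists>B. finite B \<and> a r + 1 \<le> 64 * card B \<and>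
      (\<forall>j\<in>B. \<exists>\<alpha>\<in>lattice V N. \<alpha> r = j \<and> (\<alpha> z = 0 \<or> \<alpha> y = 0) \<and>
        (\<forall>i\<in>R. a i \<le> \<alpha> i) \<and> \<theta> \<le> \<bar>g \<alpha>\<bar>)"
    using facet_points[of R z y r] insert.hyps zyR ne assms(2) unfolding VU by auto
  have "\<exists>\<B>. finite \<B> \<and> (\<Prod>i\<in>insert r R. (real (a i) + 1) / 64) \<le> real (card \<B>) \<and>
      (\<forall>b\<in>\<B>. (\<forall>i. i \<notin> insert r R \<longrightarrow> b i = 0) \<and> marked z y (insert r R) N \<theta> g b)"
    if \<theta>: "0 < \<theta>" and small: "small_sums V N \<theta> g" and a: "a \<in> lattice V N"
      and large: "(2 * K * L) ^ Suc N * \<theta> \<le> \<bar>g a\<bar>" for N g a and \<theta> :: real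
  proof -
    \<comment> \<open>Facet points this large still meet the induction hypothesis with threshold
      \<open>2 ^ N * \<theta>\<close>, the one needed for lifting back to
      \<open>\<theta>\<close>.\<close>
    define \<theta>' where "\<theta>' = K ^ Suc N * (2 ^ N * \<theta>)"
    have "1 * (1 * \<theta>) \<le> K ^ Suc N * (2 ^ N * \<theta>)"
      using K \<theta> one_le_power[OF K, of "Suc N"] by (intro mult_mono) auto
    then have "\<theta> \<le> \<theta>'" unfolding \<theta>'_def by linarith
    with \<theta> have \<theta>': "0 < \<theta>'" "\<theta> \<le> \<theta>'" by linarith+
    have "L ^ Suc N * \<theta>' \<le> L ^ Suc N * (K ^ Suc N * (2 ^ Suc N * \<theta>))"
      unfolding \<theta>'_def using K L \<theta> by (intro mult_left_mono mult_right_mono) auto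
    also have "\<dots> = (2 * K * L) ^ Suc N * \<theta>"
      by (simp only: power_mult_distrib ac_simps)
    finally have "L ^ Suc N * \<theta>' \<le> \<bar>g a\<bar>" using large by linarith
    from facets[OF \<theta>'(1) small_sums_mono[OF small \<theta>'(2)] a this] obtain B
      where B: "finite B" "a r + 1 \<le> 64 * card B"
      and pts: "\<forall>j\<in>B. \<exists>\<alpha>\<in>lattice V N. \<alpha> r = j \<and> (\<alpha> z = 0 \<or> \<alpha> y = 0) \<and>
        (\<forall>i\<in>R. a i \<le> \<alpha> i) \<and> \<theta>' \<le> \<bar>g \<alpha>\<bar>" by (elim exE conjE)
    define P where "P = (\<Prod>i\<in>R. (real (a i) + 1) / 64)"
    have fibre: "\<exists>\<B>. finite \<B> \<and> P \<le> real (card \<B>) \<and>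
      (\<forall>b\<in>\<B>. (\<forall>i. i \<notin> R \<longrightarrow> b i = 0) \<and> marked z y (insert r R) N \<theta> g (b(r := j)))" if j: "j \<in> B" for j
    proof -
      obtain \<alpha> where \<alpha>: "\<alpha> \<in> lattice V N" "\<alpha> r = j" "\<alpha> z = 0 \<or> \<alpha> y = 0"
        "\<And>i. i \<in> R \<Longrightarrow> a i \<le> \<alpha> i" "\<theta>' \<le> \<bar>g \<alpha>\<bar>"
        using bspec[OF pts j] by blast
      have N: "j \<le> N" "sum \<alpha> (V - {r}) = N - j"
        using \<alpha>(1,2) V sum.remove[of V r \<alpha>] by (auto simp: lattice_def)
      have mem: "\<alpha>(r := 0) \<in> lattice W (N - j)"
      proof -
        have "sum (\<alpha>(r := 0)) (V - {r}) = sum \<alpha> (V - {r})" by (rule sum.cong) auto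
        then show ?thesis using \<alpha>(1) N(2) unfolding VW[symmetric] by (auto simp: lattice_def)
      qed
      have P: "P \<le> (\<Prod>i\<in>R. (real ((\<alpha>(r := 0)) i) + 1) / 64)"
        unfolding P_def using \<alpha>(4) insert.hyps by (intro prod_mono) (auto simp: divide_right_mono)
      have K': "K ^ Suc (N - j) * (2 ^ N * \<theta>) \<le> \<theta>'"
        unfolding \<theta>'_def using K \<theta> by (intro mult_right_mono power_increasing) auto
      have pos: "0 < 2 ^ N * \<theta>" using \<theta> by simp
      have collect: "\<exists>\<B>. finite \<B> \<and> P \<le> real (card \<B>) \<and>
          (\<forall>b\<in>\<B>. (\<forall>i. i \<notin> R \<longrightarrow> b i = 0) \<and> marked z y R (N - j) (2 ^ N * \<theta>) (merge x r j g) b)"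
        if x: "x \<in> V" "x \<noteq> r" "\<alpha> x = 0" for x
      proof -
        \<comment> \<open>As \<open>\<alpha> x = 0\<close>, the binomial sum has a single term and
          merging loses nothing.\<close>
        have "(\<alpha>(r := 0))(r := j + 0, x := \<alpha> x - 0) = \<alpha>"
          using \<alpha>(2) x by auto
        then have "merge x r j g (\<alpha>(r := 0)) = g \<alpha>"
          using x by (simp add: merge_def)
        then have large': "K ^ Suc (N - j) * (2 ^ N * \<theta>) \<le> \<bar>merge x r j g (\<alpha>(r := 0))\<bar>"
          using K' \<alpha>(5) by linarith
        have small': "small_sums W (N - j) (2 ^ N * \<theta>) (merge x r j g)"
          using small_sums_merge[OF V(1) x(1) V(4) x(2) _ small, of j] \<theta> unfolding VW by simp
        from IH[of "2 ^ N * \<theta>" "N - j" "merge x r j g" "\<alpha>(r := 0)", OF pos small' mem large']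
        obtain \<B> where "finite \<B>" "(\<Prod>i\<in>R. (real ((\<alpha>(r := 0)) i) + 1) / 64) \<le> real (card \<B>)"
          "\<forall>b\<in>\<B>. (\<forall>i. i \<notin> R \<longrightarrow> b i = 0) \<and> marked z y R (N - j) (2 ^ N * \<theta>) (merge x r j g) b"
          by (elim exE conjE)
        then show ?thesis using P by (intro exI[of _ \<B>]) auto
      qed
      from \<alpha>(3) show ?thesis
      proof
        assume "\<alpha> z = 0"
        from collect[OF V(2) ne(1) this] show ?thesis
          using marked_lift[of R z y r j N \<theta> g] insert.hyps ne zyR N assms(2) \<theta>
          by (metis (no_types, lifting) less_imp_le)
      next
        assume "\<alpha> y = 0"
        from collect[OF V(3) ne(2) this] show ?thesis
          using marked_lift[of R y z r j N \<theta> g] insert.hyps ne zyR N assms(2) \<theta> marked_sym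
          by (metis (no_types, lifting) less_imp_le)
      qed
    qed
    then obtain \<B> where \<B>: "\<And>j. j \<in> B \<Longrightarrow> finite (\<B> j) \<and> P \<le> real (card (\<B> j)) \<and>
      (\<forall>b\<in>\<B> j. (\<forall>i. i \<notin> R \<longrightarrow> b i = 0) \<and> marked z y (insert r R) N \<theta> g (b(r := j)))"
      by metis
    define \<C> where "\<C> = (\<lambda>(j, b). b(r := j)) ` (SIGMA j:B. \<B> j)"
    \<comment> \<open>The old patterns vanish at \<open>r\<close>, so \<open>j\<close> and
      \<open>b\<close> can be recovered from \<open>b(r := j)\<close>.\<close>
    have inj: "inj_on (\<lambda>(j, b). b(r := j)) (SIGMA j:B. \<B> j)"
    proof (rule inj_onI, clarify)
      fix j b j' b' assume *: "j \<in> B" "b \<in> \<B> j" "j' \<in> B" "b' \<in> \<B> j'" "b(r := j) = b'(r := j')"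
      then have "b r = 0" "b' r = 0" using \<B> insert.hyps by blast+
      then have "b i = b' i" for i
        using fun_cong[OF *(5), of i] by (cases "i = r") auto
      then show "j = j' \<and> b = b'" using fun_cong[OF *(5), of r] by auto
    qed
    have "(\<Prod>i\<in>insert r R. (real (a i) + 1) / 64) = (real (a r) + 1) / 64 * P"
      using insert.hyps by (simp add: P_def)
    also have "\<dots> \<le> real (card B) * P"
      using B(2) by (intro mult_right_mono) (auto simp: P_def intro!: prod_nonneg)
    also have "\<dots> \<le> (\<Sum>j\<in>B. real (card (\<B> j)))"
      using sum_mono[of B "\<lambda>j. P" "\<lambda>j. real (card (\<B> j))"] \<B> by simp
    also have "\<dots> = real (card \<C>)"
      unfolding \<C>_def card_image[OF inj] using B(1) \<B> by (subst card_SigmaI) auto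
    finally have "(\<Prod>i\<in>insert r R. (real (a i) + 1) / 64) \<le> real (card \<C>)" .
    moreover have "finite \<C>" unfolding \<C>_def using B(1) \<B> by (intro finite_imageI finite_SigmaI) auto
    moreover have "\<forall>b\<in>\<C>. (\<forall>i. i \<notin> insert r R \<longrightarrow> b i = 0) \<and> marked z y (insert r R) N \<theta> g b"
      unfolding \<C>_def using \<B> by auto
    ultimately show ?thesis by blast
  qed
  moreover have "1 * 1 * 1 \<le> 2 * K * L" using K L by (intro mult_mono) auto
  ultimately show ?case unfolding V_def[symmetric] by (intro exI[of _ "2 * K * L"]) auto
qed

section \<open>Counting large points by means of the marked patterns\<close>

lemma finite_lattice: "finite V \<Longrightarrow> finite (lattice V N)"
proof -
  assume V: "finite V"
  have "lattice V N \<subseteq> {\<alpha>. \<forall>i. (i \<in> V \<longrightarrow> \<alpha> i \<in> {..N}) \<and> (i \<notin> V \<longrightarrow> \<alpha> i = 0)}"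
    using lattice_le[OF V] by (auto simp: lattice_def)
  then show ?thesis
    using finite_set_of_finite_funs[OF V, of "{..N}" "0::nat"] by (rule finite_subset) simp
qed

text \<open>Such a function is determined by its values on \<open>R - W\<close>, each between
  \<open>0\<close> and \<open>N\<close>.\<close>

lemma card_prescribed_le:
  fixes \<alpha> :: "nat \<Rightarrow> nat" and W :: "nat set" and N :: nat
  assumes "finite R"
  defines "A \<equiv> {b. (\<forall>i. i \<notin> R \<longrightarrow> b i = 0) \<and> (\<forall>i\<in>W. b i = \<alpha> i) \<and> (\<forall>i. b i \<le> N)}"
  shows "finite A \<and> card A \<le> (N + 1) ^ card (R - W)"
proof -
  define F where "F = PiE (R - W) (\<lambda>_. {..N})"
  have F: "finite F" "card F = (N + 1) ^ card (R - W)"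
    unfolding F_def using assms(1) by (auto intro: finite_PiE simp: card_PiE)
  have "A \<subseteq> (\<lambda>f i. if i \<in> R - W then f i else if i \<in> R then \<alpha> i else 0) ` F"
  proof
    fix b assume b: "b \<in> A"
    have mem: "restrict b (R - W) \<in> F"
      using b by (auto simp: A_def F_def)
    have "b = (\<lambda>i. if i \<in> R - W then restrict b (R - W) i else if i \<in> R then \<alpha> i else 0)"
      using b by (auto simp: A_def fun_eq_iff)
    then show "b \<in> (\<lambda>f i. if i \<in> R - W then f i else if i \<in> R then \<alpha> i else 0) ` F"
      using mem by (rule image_eqI)
  qed
  then show ?thesis
    using F by (metis (no_types, lifting) card_image_le card_mono finite_imageI finite_subset order.trans)
qed

text \<open>This restricts the functional to the multiples of the \<open>t\<close>-th power of the
  product of the variables \<open>z\<close> and \<open>y\<close>; the recurrence is translation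
  invariant.\<close>

lemma small_sums_shift:
  assumes V: "finite V" "z \<in> V" "y \<in> V" "z \<noteq> y" and small: "small_sums V N \<epsilon> g"
  shows "small_sums V (N - 2 * t) \<epsilon> (\<lambda>\<gamma>. g (\<gamma>(z := \<gamma> z + t, y := \<gamma> y + t)))"
  unfolding small_sums_def
proof (intro allI impI ballI)
  fix M \<beta> assume M: "N - 2 * t = Suc M" and \<beta>: "\<beta> \<in> lattice V M"
  define \<beta>' where "\<beta>' = \<beta>(z := \<beta> z + t, y := \<beta> y + t)"
  have "\<beta>' \<in> lattice V (M + 2 * t)"
    using \<beta> V sum_two_apart[OF V, of \<beta>] sum_two_apart[OF V, of \<beta>']
    by (auto simp: lattice_def \<beta>'_def)
  moreover have "N = Suc (M + 2 * t)" using M by simp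
  moreover have "(\<beta>(i := Suc (\<beta> i)))(z := (\<beta>(i := Suc (\<beta> i))) z + t, y := (\<beta>(i := Suc (\<beta> i))) y + t)
      = \<beta>'(i := Suc (\<beta>' i))" for i
    using V by (auto simp: \<beta>'_def fun_eq_iff)
  ultimately show "\<bar>\<Sum>i\<in>V. g ((\<beta>(i := Suc (\<beta> i)))(z := (\<beta>(i := Suc (\<beta> i))) z + t,
      y := (\<beta>(i := Suc (\<beta> i))) y + t))\<bar> \<le> \<epsilon>"
    using small unfolding small_sums_def by simp
qed

text \<open>After division by that power, a marked witness has \<open>z = 0\<close> or
  \<open>y = 0\<close>, so shifting it back gives minimum exactly \<open>t\<close>. Each pattern is
  then charged to a point of the slice and a set \<open>W\<close> on which they agree; a pair
  receives at most \<open>(N + 1) ^ (card R div 2)\<close> patterns.\<close>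

lemma large_slice:
  assumes R: "finite R" "z \<noteq> y" "z \<notin> R" "y \<notin> R"
  defines "V \<equiv> insert z (insert y R)"
  assumes K: "(1::real) \<le> K" and marks: "\<And>N g a \<theta>. 0 < \<theta> \<Longrightarrow> small_sums V N \<theta> g \<Longrightarrow>
      a \<in> lattice V N \<Longrightarrow> K ^ Suc N * \<theta> \<le> \<bar>g a\<bar> \<Longrightarrow>
      \<exists>\<B>. finite \<B> \<and> (\<Prod>i\<in>R. (real (a i) + 1) / 64) \<le> real (card \<B>) \<and>
      (\<forall>b\<in>\<B>. (\<forall>i. i \<notin> R \<longrightarrow> b i = 0) \<and> marked z y R N \<theta> g b)"
    and \<theta>: "0 < \<theta>" and small: "small_sums V N \<theta> g" and a: "a \<in> lattice V N"
    and large: "K ^ Suc N * \<theta> \<le> \<bar>g a\<bar>" and t: "t \<le> a z" "t \<le> a y"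
  shows "(\<Prod>i\<in>R. (real (a i) + 1) / 64) \<le> 2 ^ card R * (real N + 1) ^ (card R div 2) *
    real (card {\<alpha> \<in> lattice V N. \<theta> \<le> \<bar>g \<alpha>\<bar> \<and> min (\<alpha> z) (\<alpha> y) = t})"
proof -
  define S where "S = {\<alpha> \<in> lattice V N. \<theta> \<le> \<bar>g \<alpha>\<bar> \<and> min (\<alpha> z) (\<alpha> y) = t}"
  have V: "finite V" "z \<in> V" "y \<in> V" "z \<noteq> y" using R by (auto simp: V_def)
  have zyR: "i \<noteq> z" "i \<noteq> y" if "i \<in> R" for i using that R by auto
  define s where "s \<gamma> = \<gamma>(z := \<gamma> z + t, y := \<gamma> y + t)" for \<gamma> :: "nat \<Rightarrow> nat"
  define a' where "a' = a(z := a z - t, y := a y - t)"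
  have "s a' = a" using t V by (auto simp: s_def a'_def)
  have N2: "2 * t \<le> N" "a' \<in> lattice V (N - 2 * t)"
    using a t V sum_two_apart[OF V, of a] sum_two_apart[OF V, of a']
    by (auto simp: lattice_def a'_def)
  have "K ^ Suc (N - 2 * t) * \<theta> \<le> K ^ Suc N * \<theta>"
    using K \<theta> by (intro mult_right_mono power_increasing) auto
  then have "K ^ Suc (N - 2 * t) * \<theta> \<le> \<bar>g (s a')\<bar>"
    unfolding \<open>s a' = a\<close> using large by linarith
  moreover have "small_sums V (N - 2 * t) \<theta> (\<lambda>\<gamma>. g (s \<gamma>))"
    unfolding s_def by (rule small_sums_shift[OF V small])
  ultimately obtain \<B> where \<B>: "finite \<B>" "(\<Prod>i\<in>R. (real (a' i) + 1) / 64) \<le> real (card \<B>)"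
    and mark: "\<forall>b\<in>\<B>. (\<forall>i. i \<notin> R \<longrightarrow> b i = 0) \<and> marked z y R (N - 2 * t) \<theta> (\<lambda>\<gamma>. g (s \<gamma>)) b"
    using marks[of \<theta> "N - 2 * t" "\<lambda>\<gamma>. g (s \<gamma>)" a'] \<theta> N2(2) by blast
  have s_mem: "s \<gamma> \<in> lattice V N" if "\<gamma> \<in> lattice V (N - 2 * t)" for \<gamma>
    using that N2(1) V sum_two_apart[OF V, of \<gamma>] sum_two_apart[OF V, of "s \<gamma>"]
    by (auto simp: lattice_def s_def)
  define Q where "Q W \<alpha> = {b. (\<forall>i. i \<notin> R \<longrightarrow> b i = 0) \<and> (\<forall>i\<in>W. b i = \<alpha> i) \<and> (\<forall>i. b i \<le> N)}"
    for W and \<alpha> :: "nat \<Rightarrow> nat"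
  \<comment> \<open>the coordinates outside \<open>W\<close> are not controlled by the large point and cost a factor \<open>N + 1\<close> each\<close>
  define \<W> where "\<W> = {W. W \<subseteq> R \<and> card (R - W) \<le> card R div 2}"
  have cover: "\<B> \<subseteq> (\<Union>(\<alpha>, W)\<in>S \<times> \<W>. Q W \<alpha>)"
  proof
    fix b assume "b \<in> \<B>"
    then have b0: "\<And>i. i \<notin> R \<Longrightarrow> b i = 0" and "marked z y R (N - 2 * t) \<theta> (\<lambda>\<gamma>. g (s \<gamma>)) b"
      using mark by blast+
    then obtain U \<gamma> \<gamma>' where U: "U \<subseteq> R"
      and \<gamma>: "\<gamma> \<in> lattice V (N - 2 * t)" "\<gamma> z = 0" "\<forall>i\<in>U. \<gamma> i = b i" "\<theta> \<le> \<bar>g (s \<gamma>)\<bar>"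
      and \<gamma>': "\<gamma>' \<in> lattice V (N - 2 * t)" "\<gamma>' y = 0" "\<forall>i\<in>R - U. \<gamma>' i = b i" "\<theta> \<le> \<bar>g (s \<gamma>')\<bar>"
      unfolding marked_def V_def[symmetric] by blast
    have bN: "b i \<le> N" for i
    proof -
      consider "i \<notin> R" | "i \<in> U" | "i \<in> R - U" by blast
      then show ?thesis
      proof cases
        case 2
        then show ?thesis using \<gamma>(3) lattice_le[OF V(1) \<gamma>(1), of i] by fastforce
      next
        case 3
        then show ?thesis using \<gamma>'(3) lattice_le[OF V(1) \<gamma>'(1), of i] by fastforce
      qed (simp add: b0)
    qed
    have S: "s \<gamma> \<in> S" "s \<gamma>' \<in> S"
      using s_mem[OF \<gamma>(1)] s_mem[OF \<gamma>'(1)] \<gamma>(2,4) \<gamma>'(2,4) V by (auto simp: S_def s_def)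
    have Q: "b \<in> Q U (s \<gamma>)" "b \<in> Q (R - U) (s \<gamma>')"
      using b0 bN \<gamma>(3) \<gamma>'(3) U R(3,4) by (auto simp: Q_def s_def)
    have "card R = card U + card (R - U)"
      using U R(1) by (metis card_Diff_subset card_mono finite_subset le_add_diff_inverse)
    \<comment> \<open>\<open>U\<close> and \<open>R - U\<close> are complementary, so one of the two
      sets misses at most half of \<open>R\<close>.\<close>
    then have "card (R - U) \<le> card R div 2 \<or> card (R - (R - U)) \<le> card R div 2"
      using U by (simp add: double_diff) linarith
    then have "U \<in> \<W> \<or> R - U \<in> \<W>"
      using U by (auto simp: \<W>_def)
    then show "b \<in> (\<Union>(\<alpha>, W)\<in>S \<times> \<W>. Q W \<alpha>)"
      using S Q by blast
  qed
  have fin: "finite S" "finite \<W>"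
    unfolding S_def \<W>_def using finite_lattice[OF V(1)] R(1) by auto
  have "\<W> \<subseteq> Pow R" by (auto simp: \<W>_def)
  then have card\<W>: "card \<W> \<le> 2 ^ card R"
    using card_mono[of "Pow R" \<W>] R(1) by (simp add: card_Pow)
  have Q: "finite (Q W \<alpha>)" "W \<in> \<W> \<Longrightarrow> card (Q W \<alpha>) \<le> (N + 1) ^ (card R div 2)" for W \<alpha>
  proof -
    have *: "finite (Q W \<alpha>)" "card (Q W \<alpha>) \<le> (N + 1) ^ card (R - W)"
      using card_prescribed_le[OF R(1), of W \<alpha> N] unfolding Q_def by auto
    show "finite (Q W \<alpha>)" by (rule *)
    assume "W \<in> \<W>"
    then have "(N + 1) ^ card (R - W) \<le> (N + 1) ^ (card R div 2)"
      by (intro power_increasing) (auto simp: \<W>_def)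
    then show "card (Q W \<alpha>) \<le> (N + 1) ^ (card R div 2)" using *(2) by linarith
  qed
  have "card \<B> \<le> card (\<Union>(\<alpha>, W)\<in>S \<times> \<W>. Q W \<alpha>)"
    using fin Q by (intro card_mono cover) auto
  also have "\<dots> \<le> (\<Sum>(\<alpha>, W)\<in>S \<times> \<W>. card (Q W \<alpha>))"
    using card_UN_le[of "S \<times> \<W>" "\<lambda>(\<alpha>, W). Q W \<alpha>"] fin by (simp add: case_prod_unfold)
  also have "\<dots> \<le> (\<Sum>(\<alpha>, W)\<in>S \<times> \<W>. (N + 1) ^ (card R div 2))"
    using Q(2) by (intro sum_mono) auto
  also have "\<dots> = card S * card \<W> * (N + 1) ^ (card R div 2)"
    by (simp add: case_prod_unfold card_cartesian_product)
  also have "\<dots> \<le> card S * 2 ^ card R * (N + 1) ^ (card R div 2)"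
    using card\<W> by simp
  finally have "real (card \<B>) \<le> real (card S * 2 ^ card R * (N + 1) ^ (card R div 2))"
    by (rule of_nat_mono)
  moreover have "(\<Prod>i\<in>R. (real (a' i) + 1) / 64) = (\<Prod>i\<in>R. (real (a i) + 1) / 64)"
    using zyR by (intro prod.cong) (auto simp: a'_def)
  ultimately show ?thesis
    using \<B>(2) unfolding S_def[symmetric] by (simp add: ac_simps)
qed

theorem theorem2p2:
  fixes n :: nat
  assumes "n \<ge> 3"
  shows "\<exists>c C :: real. c > 0 \<and> C > 0 \<and>
    (\<forall>N :: nat. N \<ge> 1 \<longrightarrow>
      (\<forall>a \<in> simplex_lattice n N. (\<forall>i \<in> {1..<n}. a i \<ge> a (i + 1)) \<longrightarrow>
        (\<forall>g :: (nat \<Rightarrow> nat) \<Rightarrow> real.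
          g a \<noteq> 0 \<longrightarrow>
          (\<forall>\<beta> \<in> simplex_lattice n (N - 1).
             \<bar>\<Sum>i = 1..n. g (vec_add \<beta> (coord_vec i))\<bar> \<le> exp (- C * real N) * \<bar>g a\<bar>) \<longrightarrow>
          real (card {\<alpha> \<in> simplex_lattice n N. \<bar>g \<alpha>\<bar> \<ge> exp (- C * real N) * \<bar>g a\<bar>})
            \<ge> c * Phi n N a)))"
proof -
  \<comment> \<open>The last two variables serve as the pair \<open>z\<close>, \<open>y\<close>; the
    others form the index range of the product in \<open>Phi\<close>.\<close>
  define z where "z = n - 1"
  define R where "R = {1..n - 2}"
  have R: "finite R" "z \<noteq> n" "z \<notin> R" "n \<notin> R" and card_R: "card R = n - 2"
    using assms by (auto simp: R_def z_def)
  have V: "insert z (insert n R) = {1..n}"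
    using assms by (auto simp: R_def z_def)
  have lattice: "lattice {1..n} N = simplex_lattice n N" for N
    by (simp add: lattice_def simplex_lattice_def)
  obtain K :: real where K: "1 \<le> K" and marks: "\<And>N g a \<theta>. 0 < \<theta> \<Longrightarrow> small_sums {1..n} N \<theta> g \<Longrightarrow>
      a \<in> lattice {1..n} N \<Longrightarrow> K ^ Suc N * \<theta> \<le> \<bar>g a\<bar> \<Longrightarrow>
      \<exists>\<B>. finite \<B> \<and> (\<Prod>i\<in>R. (real (a i) + 1) / 64) \<le> real (card \<B>) \<and>
      (\<forall>b\<in>\<B>. (\<forall>i. i \<notin> R \<longrightarrow> b i = 0) \<and> marked z n R N \<theta> g b)"
    using many_marked[OF R] unfolding V by auto
  \<comment> \<open>For \<open>N \<ge> 1\<close> this gives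
    \<open>K ^ Suc N \<le> (K + 1) ^ (2 * N) = exp (C * N)\<close>; the summand 1 makes
    \<open>C\<close> positive.\<close>
  define C where "C = 2 * ln (K + 1)"
  \<comment> \<open>One factor comes from the quotients by 64, the other from the number of subsets
    \<open>W\<close> of \<open>R\<close>.\<close>
  define c :: real where "c = 1 / (64 ^ (n - 2) * 2 ^ (n - 2))"
  have "c * Phi n N a \<le> real (card {\<alpha> \<in> simplex_lattice n N. \<bar>g \<alpha>\<bar> \<ge> exp (- C * real N) * \<bar>g a\<bar>})"
    if N: "N \<ge> 1" and a: "a \<in> simplex_lattice n N" and dec: "\<forall>i\<in>{1..<n}. a i \<ge> a (i + 1)"
      and ga: "g a \<noteq> 0" and sums: "\<forall>\<beta> \<in> simplex_lattice n (N - 1).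
             \<bar>\<Sum>i = 1..n. g (vec_add \<beta> (coord_vec i))\<bar> \<le> exp (- C * real N) * \<bar>g a\<bar>"
    for N a and g :: "(nat \<Rightarrow> nat) \<Rightarrow> real"
  proof -
    define \<theta> where "\<theta> = exp (- C * real N) * \<bar>g a\<bar>"
    have \<theta>: "0 < \<theta>" using ga by (simp add: \<theta>_def)
    have "vec_add \<beta> (coord_vec i) = \<beta>(i := Suc (\<beta> i))" for \<beta> i
      by (auto simp: vec_add_def coord_vec_def)
    then have small: "small_sums {1..n} N \<theta> g"
      using sums unfolding small_sums_def lattice \<theta>_def by auto
    have "K ^ Suc N \<le> (K + 1) ^ Suc N" using K by (intro power_mono) auto
    also have "\<dots> \<le> (K + 1) ^ (2 * N)" using K N by (intro power_increasing) auto
    also have "\<dots> = exp (real (2 * N) * ln (K + 1))"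
      using K by (simp only: exp_of_nat_mult) simp
    also have "\<dots> = exp (C * real N)"
      by (simp add: C_def mult_ac)
    finally have "K ^ Suc N * \<theta> \<le> exp (C * real N) * \<theta>"
      using \<theta> by (intro mult_right_mono) auto
    also have "\<dots> = \<bar>g a\<bar>" by (simp add: \<theta>_def exp_minus)
    finally have large: "K ^ Suc N * \<theta> \<le> \<bar>g a\<bar>" .
    define S where "S t = {\<alpha> \<in> lattice {1..n} N. \<theta> \<le> \<bar>g \<alpha>\<bar> \<and> min (\<alpha> z) (\<alpha> n) = t}" for t
    define P where "P = (\<Prod>i\<in>R. (real (a i) + 1) / 64)"
    define D where "D = 2 ^ (n - 2) * (real N + 1) ^ ((n - 2) div 2)"
    \<comment> \<open>The ordering of \<open>a\<close> enters here: every \<open>t \<le> a n\<close>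
      can be subtracted from both coordinates.\<close>
    have "a n \<le> a z" using dec assms by (auto simp: z_def dest: bspec[of _ _ "n - 1"])
    then have slice: "P \<le> D * real (card (S t))" if "t \<le> a n" for t
      using large_slice[OF R K, unfolded V card_R, OF marks \<theta> small _ large, of t] a that
      unfolding P_def D_def S_def lattice by auto
    have fin: "finite (S t)" for t
      unfolding S_def by (simp add: finite_lattice)
    have "(real (a n) + 1) * P = (\<Sum>t\<le>a n. P)" by simp
    also have "\<dots> \<le> (\<Sum>t\<le>a n. D * real (card (S t)))"
      using slice by (intro sum_mono) auto
    \<comment> \<open>A point determines its \<open>t\<close> as a minimum, so the slices are
      disjoint.\<close>
    also have "\<dots> = D * real (card (\<Union>t\<le>a n. S t))"
      using fin by (subst card_UN_disjoint) (auto simp: S_def sum_distrib_left)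
    also have "\<dots> \<le> D * real (card {\<alpha> \<in> simplex_lattice n N. \<theta> \<le> \<bar>g \<alpha>\<bar>})"
      unfolding D_def S_def lattice
      by (intro mult_left_mono of_nat_mono card_mono) (auto simp: finite_simplex_lattice)
    finally have main: "(real (a n) + 1) * P \<le> D * real (card {\<alpha> \<in> simplex_lattice n N. \<theta> \<le> \<bar>g \<alpha>\<bar>})" .
    have P_eq: "P = (\<Prod>i\<in>R. (real (a i) + 1)) / 64 ^ (n - 2)"
      unfolding P_def by (simp add: prod_dividef card_R)
    have "c * Phi n N a = (real (a n) + 1) * P / D"
      unfolding c_def Phi_def D_def P_eq R_def by (simp add: mult_ac)
    also have "\<dots> \<le> real (card {\<alpha> \<in> simplex_lattice n N. \<theta> \<le> \<bar>g \<alpha>\<bar>})"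
      using main by (subst pos_divide_le_eq) (auto simp: D_def mult.commute)
    finally show ?thesis unfolding \<theta>_def .
  qed
  moreover have "c > 0" "C > 0"
    using K by (auto simp: c_def C_def)
  ultimately show ?thesis by blast
qed

end
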